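(* Let $\phi:=\{\phi_n\}_{n\in\mathbb N}$ and $\psi:=\{\psi_n\}_{n\in\mathbb N}$ be bi-orthogonal and total sequences of $\mathcal H$. Then $D(C_\phi)$ is dense in $\mathcal H$. Moreover, if $\mathsf T_\phi$ is the generalized frame operator of $\phi$, then $\phi_n\in R(\mathsf T_\phi)\subset R(\mathsf T_\phi^{1/2})$ for all $n\in\mathbb N$, and $\{\mathsf T_\phi^{-1/2}\phi_n\}_{n\in\mathbb N}$ is an orthonormal basis of $\mathcal H$.
   Context: $\mathcal H$ is a separable Hilbert space with inner product $\langle\cdot|\cdot\rangle$ linear in the first factor. Two sequences $\{\phi_n\}_{n\in\mathbb N}$, $\{\psi_n\}_{n\in\mathbb N}$ in $\mathcal H$ are bi-orthogonal if $\langle\psi_n|\phi_m\rangle=\delta_{n,m}$ for all $n,m$. A sequence $\{\phi_n\}$ is total if $\langle f|\phi_n\rangle=0$ for all $n$ implies $f=0$. The analysis operator of $\phi$ is $C_\phi:D(C_\phi)\subseteq\mathcal H\to\ell^2(\mathbb N)$, with $D(C_\phi)=\{f\in\mathcal H:\sum_{n\in\mathbb N}|\langle f|\phi_n\rangle|^2<\infty\}$ and $C_\phi f=\{\langle f|\phi_n\rangle\}_{n}$; it is closed. When $D(C_\phi)$ is dense, the generalized frame operator $\mathsf T_\phi$ is the non-negative self-adjoint operator on $\mathcal H$ associated by Kato's representation theorem to the closed non-negative form $\Omega_\phi(f,g)=\sum_{n}\langle f|\phi_n\rangle\langle\phi_n|g\rangle$, $f,g\in D(C_\phi)$; that is, $\mathsf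 T_\phi=C_\phi^*C_\phi$, $D(\mathsf T_\phi)\subset D(C_\phi)=D(\mathsf T_\phi^{1/2})$, and $\Omega_\phi(f,g)=\langle\mathsf T_\phi f|g\rangle$ for $f\in D(\mathsf T_\phi)$, $g\in D(C_\phi)$. $R(\cdot)$ denotes the range of an operator. Since $\phi$ is total, $\mathsf T_\phi$ is injective, and $\mathsf T_\phi^{-1/2}$ denotes the inverse of $\mathsf T_\phi^{1/2}$, with domain $R(\mathsf T_\phi^{1/2})$. *)

theory Defs
  imports "HOL-Analysis.Analysis"
begin

section \<open>Complex Hilbert spaces\<close>

class complex_vector = real_vector +
  fixes scaleC :: "complex \<Rightarrow> 'a \<Rightarrow> 'a" (infixr "*\<^sub>C" 75)
  assumes scaleC_add_right: "a *\<^sub>C (x + y) = a *\<^sub>C x + a *\<^sub>C y"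
    and scaleC_add_left: "(a + b) *\<^sub>C x = a *\<^sub>C x + b *\<^sub>C x"
    and scaleC_scaleC: "a *\<^sub>C (b *\<^sub>C x) = (a * b) *\<^sub>C x"
    and scaleC_one: "1 *\<^sub>C x = x"
    and scaleR_scaleC: "r *\<^sub>R x = complex_of_real r *\<^sub>C x"

text \<open>The inner product is linear in its \<^emph>\<open>first\<close> argument.\<close>

class complex_inner = complex_vector + real_normed_vector +
  fixes cinner :: "'a \<Rightarrow> 'a \<Rightarrow> complex"
  assumes cinner_commute: "cinner x y = cnj (cinner y x)"
    and cinner_add_left: "cinner (x + y) z = cinner x z + cinner y z"
    and cinner_scaleC_left: "cinner (a *\<^sub>C x) y = a * cinner x y"
    and cinner_ge_zero: "cinner x x \<in> \<real>\<^sub>\<ge>\<^sub>0"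
    and cinner_eq_zero_iff: "cinner x x = 0 \<longleftrightarrow> x = 0"
    and norm_eq_sqrt_cinner: "norm x = sqrt (Re (cinner x x))"

class complex_hilbert = complex_inner + complete_space


section \<open>Sequences in a Hilbert space\<close>

definition biorthogonal :: "(nat \<Rightarrow> 'a::complex_inner) \<Rightarrow> (nat \<Rightarrow> 'a) \<Rightarrow> bool" where
  "biorthogonal \<phi> \<psi> \<longleftrightarrow> (\<forall>n m. cinner (\<psi> n) (\<phi> m) = (if n = m then 1 else 0))"

definition total_seq :: "(nat \<Rightarrow> 'a::complex_inner) \<Rightarrow> bool" where
  "total_seq \<phi> \<longleftrightarrow> (\<forall>f. (\<forall>n. cinner f (\<phi> n) = 0) \<longrightarrow> f = 0)"

definition orthonormal_basis :: "(nat \<Rightarrow> 'a::complex_inner) \<Rightarrow> bool" where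
  "orthonormal_basis e \<longleftrightarrow>
     (\<forall>n m. cinner (e n) (e m) = (if n = m then 1 else 0)) \<and>
     (\<forall>f. (\<lambda>n. cinner f (e n) *\<^sub>C e n) sums f)"


section \<open>Unbounded operators\<close>

text \<open>
  A partially defined operator is identified with its graph, so that domain, range, composition and
  inverse are \<^const>\<open>Domain\<close>, \<^const>\<open>Range\<close>, \<^const>\<open>relcomp\<close> and \<^const>\<open>converse\<close>, and equality
  of operators includes equality of domains. The value \<open>op_app T f\<close> is meaningful only if
  \<open>T\<close> is single-valued and \<open>f \<in> Domain T\<close>.
\<close>

definition op_app :: "('a \<times> 'b) set \<Rightarrow> 'a \<Rightarrow> 'b" where
  "op_app T f = (THE h. (f, h) \<in> T)"

definition linear_operator :: "('a::complex_vector \<times> 'b::complex_vector) set \<Rightarrow> bool" where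
  "linear_operator T \<longleftrightarrow>
     (0, 0) \<in> T \<and>
     (\<forall>(f, h)\<in>T. \<forall>(g, k)\<in>T. (f + g, h + k) \<in> T) \<and>
     (\<forall>a. \<forall>(f, h)\<in>T. (a *\<^sub>C f, a *\<^sub>C h) \<in> T) \<and>
     single_valued T"

definition densely_defined :: "('a::topological_space \<times> 'b) set \<Rightarrow> bool" where
  "densely_defined T \<longleftrightarrow> closure (Domain T) = UNIV"

definition adjoint_op :: "('a::complex_inner \<times> 'b::complex_inner) set \<Rightarrow> ('b \<times> 'a) set" where
  "adjoint_op T = {(g, h). \<forall>(f, k)\<in>T. cinner k g = cinner f h}"

definition self_adjoint :: "('a::complex_inner \<times> 'a) set \<Rightarrow> bool" where
  "self_adjoint T \<longleftrightarrow> linear_operator T \<and> densely_defined T \<and> adjoint_op T = T"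

definition nonneg_op :: "('a::complex_inner \<times> 'a) set \<Rightarrow> bool" where
  "nonneg_op T \<longleftrightarrow> (\<forall>(f, h)\<in>T. cinner h f \<in> \<real>\<^sub>\<ge>\<^sub>0)"

text \<open>
  The unique non-negative self-adjoint square root; meaningful if \<open>T\<close> is non-negative and
  self-adjoint.
\<close>

definition sqrt_op :: "('a::complex_inner \<times> 'a) set \<Rightarrow> ('a \<times> 'a) set" where
  "sqrt_op T = (THE S. self_adjoint S \<and> nonneg_op S \<and> S O S = T)"

text \<open>
  The operator associated with a sesquilinear form \<open>\<Omega>\<close> with form domain \<open>D\<close>, as in Kato's
  representation theorem: \<open>f\<close> is in its domain iff \<open>f \<in> D\<close> and \<open>\<Omega> f\<close> is represented on \<open>D\<close> by
  some vector \<open>h\<close>, which is then the value at \<open>f\<close> (unique when \<open>D\<close> is dense).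
\<close>

definition form_operator ::
    "'a::complex_inner set \<Rightarrow> ('a \<Rightarrow> 'a \<Rightarrow> complex) \<Rightarrow> ('a \<times> 'a) set" where
  "form_operator D \<Omega> = {(f, h). f \<in> D \<and> (\<forall>g\<in>D. \<Omega> f g = cinner h g)}"


section \<open>Analysis and generalized frame operators\<close>

text \<open>The values are square-summable sequences, represented as functions on \<^typ>\<open>nat\<close>.\<close>

definition analysis_op :: "(nat \<Rightarrow> 'a::complex_inner) \<Rightarrow> ('a \<times> (nat \<Rightarrow> complex)) set" where
  "analysis_op \<phi> =
     {(f, c). summable (\<lambda>n. (cmod (cinner f (\<phi> n)))\<^sup>2) \<and> c = (\<lambda>n. cinner f (\<phi> n))}"

definition frame_form :: "(nat \<Rightarrow> 'a::complex_inner) \<Rightarrow> 'a \<Rightarrow> 'a \<Rightarrow> complex" where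
  "frame_form \<phi> f g = (\<Sum>n. cinner f (\<phi> n) * cinner (\<phi> n) g)"

definition gen_frame_op :: "(nat \<Rightarrow> 'a::complex_inner) \<Rightarrow> ('a \<times> 'a) set" where
  "gen_frame_op \<phi> = form_operator (Domain (analysis_op \<phi>)) (frame_form \<phi>)"

end

theory Submission
  imports Defs
begin

text \<open>
  Write \<open>C\<close> for the analysis operator of \<open>\<phi>\<close>, \<open>D\<close> for its domain, \<open>\<Omega>\<close> for the frame form and
  \<open>T\<close> for the generalized frame operator. Biorthogonality says that \<open>C \<psi>\<^sub>n\<close> is the \<open>n\<close>-th unit
  sequence. So every \<open>\<psi>\<^sub>n\<close> lies in \<open>D\<close>, and \<open>D\<close> is dense because \<open>\<psi>\<close> is total. Also
  \<open>\<Omega> \<psi>\<^sub>n g = \<langle>\<phi>\<^sub>n|g\<rangle>\<close> for all \<open>g \<in> D\<close>, that is, \<open>T \<psi>\<^sub>n = \<phi>\<^sub>n\<close>. If \<open>S\<close> is the square root of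
  \<open>T\<close>, the vectors in question are therefore \<open>e\<^sub>n = S \<psi>\<^sub>n\<close>, and
  \<open>\<langle>e\<^sub>n|e\<^sub>m\<rangle> = \<langle>\<psi>\<^sub>n|S e\<^sub>m\<rangle> = \<langle>\<psi>\<^sub>n|\<phi>\<^sub>m\<rangle>\<close> gives orthonormality. For \<open>u = S g\<close> with \<open>g\<close> in the domain
  of \<open>T\<close>, one has \<open>\<langle>u|e\<^sub>n\<rangle> = \<langle>g|\<phi>\<^sub>n\<rangle>\<close> and \<open>\<parallel>u\<parallel>\<^sup>2 = \<langle>T g|g\<rangle> = \<Omega> g g = \<Sum>|\<langle>g|\<phi>\<^sub>n\<rangle>|\<^sup>2\<close>. This is
  Parseval's identity for \<open>u\<close>; such \<open>u\<close> are dense (\<open>dense_Domain_Int_Range\<close>), and Parseval's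
  identity on a dense set makes an orthonormal sequence a basis (\<open>orthonormal_basisI\<close>).

  The bulk of the work is to show that \<open>S\<close> exists and is unique, without the spectral theorem.

  Minimising \<open>\<parallel>f - h\<parallel>\<^sup>2 + \<Omega> f f\<close> over \<open>D\<close> solves \<open>f + T f = h\<close> weakly. This produces the bounded
  resolvent \<open>R = (1 + T)\<^sup>-\<^sup>1\<close>, with \<open>0 \<le> R \<le> 1\<close>, and describes \<open>T\<close> as the graph of all pairs
  \<open>(R u, u - R u)\<close> (\<open>resolvent\<close>, \<open>form_operator_eq_range\<close>). With the zero form the same
  minimisation is the orthogonal projection, which yields all density statements
  (\<open>dense_if_orthogonal_trivial\<close>).

  A bounded hermitian \<open>R\<close> with \<open>\<parallel>1 - R\<parallel> \<le> 1\<close> has a square root that commutes with everything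
  commuting with \<open>R\<close> (\<open>bounded_sqrt\<close>). Let \<open>B\<close> and \<open>A\<close> be such roots of \<open>R\<close> and \<open>1 - R\<close>. They
  commute and satisfy \<open>A\<^sup>2 + B\<^sup>2 = 1\<close>, and these identities alone show that the graph of all
  \<open>(B x, A x)\<close>, i.e. \<open>A B\<^sup>-\<^sup>1\<close>, is self-adjoint with square \<open>T\<close> (locale \<open>cosine_sine_pair\<close>).
  Conversely, for any non-negative self-adjoint root \<open>S\<close> of \<open>T\<close> the operator \<open>S R\<close> is bounded,
  non-negative and has square \<open>R - R\<^sup>2 = (A B)\<^sup>2\<close>. Uniqueness of bounded roots gives
  \<open>S R = A B\<close>, which determines \<open>S\<close> (\<open>positive_sqrt_ex1\<close>).
\<close>

section \<open>Complex inner product spaces\<close>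

lemma scaleC_zero_left: "0 *\<^sub>C (x::'a::complex_vector) = 0"
  using scaleR_scaleC[of 0 x] by simp

lemma scaleC_minus_one: "(-1) *\<^sub>C (x::'a::complex_vector) = - x"
  using scaleR_scaleC[of "-1" x] by simp

lemma scaleC_scaleR_commute:
  "c *\<^sub>C (r *\<^sub>R (x::'a::complex_vector)) = r *\<^sub>R (c *\<^sub>C x)"
  by (simp add: scaleR_scaleC scaleC_scaleC mult.commute)

lemma cinner_scaleC_right: "cinner x (a *\<^sub>C y) = cnj a * cinner (x::'a::complex_inner) y"
  by (metis cinner_commute cinner_scaleC_left complex_cnj_mult complex_cnj_cnj)

lemma cinner_add_right: "cinner (x::'a::complex_inner) (y + z) = cinner x y + cinner x z"
  by (metis cinner_commute cinner_add_left complex_cnj_add)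

lemma cinner_zero_left [simp]: "cinner 0 (x::'a::complex_inner) = 0"
  using cinner_scaleC_left[of 0 0 x] by (simp add: scaleC_zero_left)

lemma cinner_zero_right [simp]: "cinner (x::'a::complex_inner) 0 = 0"
  using cinner_scaleC_right[of x 0 0] by (simp add: scaleC_zero_left)

lemma cinner_minus_left: "cinner (- x) (y::'a::complex_inner) = - cinner x y"
  using cinner_scaleC_left[of "-1" x y] by (simp add: scaleC_minus_one)

lemma cinner_minus_right: "cinner x (- (y::'a::complex_inner)) = - cinner x y"
  using cinner_scaleC_right[of x "-1" y] by (simp add: scaleC_minus_one)

lemma cinner_diff_left: "cinner (x - y) (z::'a::complex_inner) = cinner x z - cinner y z"
  using cinner_add_left[of x "- y" z] by (simp add: cinner_minus_left)

lemma cinner_diff_right: "cinner (z::'a::complex_inner) (x - y) = cinner z x - cinner z y"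
  using cinner_add_right[of z x "- y"] by (simp add: cinner_minus_right)

lemma cinner_scaleR_left: "cinner (r *\<^sub>R x) (y::'a::complex_inner) = of_real r * cinner x y"
  by (simp add: scaleR_scaleC cinner_scaleC_left)

lemma cinner_scaleR_right: "cinner x (r *\<^sub>R (y::'a::complex_inner)) = of_real r * cinner x y"
  by (simp add: scaleR_scaleC cinner_scaleC_right)

lemmas cinner_simps = cinner_add_left cinner_add_right cinner_diff_left cinner_diff_right
  cinner_minus_left cinner_minus_right cinner_scaleR_left cinner_scaleR_right
  cinner_scaleC_left cinner_scaleC_right

lemma cinner_self: "cinner x (x::'a::complex_inner) = of_real ((norm x)\<^sup>2)"
  using cinner_ge_zero[of x] norm_eq_sqrt_cinner[of x]
  by (auto simp: complex_nonneg_Reals_iff complex_eq_iff)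

lemma Re_cinner_self: "Re (cinner x (x::'a::complex_inner)) = (norm x)\<^sup>2"
  by (simp add: cinner_self)

lemma Re_cinner_commute: "Re (cinner x y) = Re (cinner y (x::'a::complex_inner))"
  by (subst cinner_commute) simp

lemma norm_scaleC: "norm (c *\<^sub>C (x::'a::complex_inner)) = cmod c * norm x"
proof -
  have "cinner (c *\<^sub>C x) (c *\<^sub>C x) = (c * cnj c) * cinner x x"
    by (simp add: cinner_scaleC_left cinner_scaleC_right)
  then have "complex_of_real ((norm (c *\<^sub>C x))\<^sup>2) = of_real ((cmod c)\<^sup>2 * (norm x)\<^sup>2)"
    by (simp only: cinner_self complex_norm_square[symmetric] of_real_mult)
  then have "(norm (c *\<^sub>C x))\<^sup>2 = (cmod c * norm x)\<^sup>2"
    by (simp only: of_real_eq_iff power_mult_distrib)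
  then show ?thesis by (simp add: power2_eq_iff_nonneg)
qed

lemma norm_diff_sq:
  "(norm (x - y))\<^sup>2 = (norm x)\<^sup>2 - 2 * Re (cinner x y) + (norm (y::'a::complex_inner))\<^sup>2"
  using Re_cinner_commute[of x y] by (simp add: Re_cinner_self[symmetric] cinner_simps)

lemma norm_add_sq:
  "(norm (x + y))\<^sup>2 = (norm x)\<^sup>2 + 2 * Re (cinner x y) + (norm (y::'a::complex_inner))\<^sup>2"
  using Re_cinner_commute[of x y] by (simp add: Re_cinner_self[symmetric] cinner_simps)

lemma cinner_cauchy_schwarz: "cmod (cinner x y) \<le> norm x * norm (y::'a::complex_inner)"
proof (cases "y = 0")
  case False
  then have y: "norm y > 0" by simp
  define c where "c = cinner x y / of_real ((norm y)\<^sup>2)"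
  \<comment> \<open>\<open>c *\<^sub>C y\<close> is the projection of \<open>x\<close> to the line of \<open>y\<close>\<close>
  have "0 \<le> (norm (x - c *\<^sub>C y))\<^sup>2" by simp
  also have "\<dots> = (norm x)\<^sup>2 - 2 * Re (cnj c * cinner x y) + (cmod c * norm y)\<^sup>2"
    by (simp add: norm_diff_sq cinner_simps norm_scaleC)
  also have "cnj c * cinner x y = of_real ((cmod (cinner x y))\<^sup>2 / (norm y)\<^sup>2)"
    using complex_norm_square[of "cinner x y"] by (simp add: c_def mult.commute)
  also have "(cmod c * norm y)\<^sup>2 = (cmod (cinner x y))\<^sup>2 / (norm y)\<^sup>2"
    using y by (simp add: c_def norm_divide norm_mult power_mult_distrib power_divide norm_power)
      (simp add: power2_eq_square field_simps power4_eq_xxxx)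
  finally have "(cmod (cinner x y))\<^sup>2 \<le> (norm x * norm y)\<^sup>2"
    using y by (simp add: field_simps power_mult_distrib)
  then show ?thesis by (rule power2_le_imp_le) simp
qed simp

lemma Re_cinner_le: "Re (cinner x y) \<le> norm x * norm (y::'a::complex_inner)"
  using cinner_cauchy_schwarz[of x y] complex_Re_le_cmod order_trans by blast

lemma bounded_bilinear_cinner:
  "bounded_bilinear (cinner :: 'a::complex_inner \<Rightarrow> 'a \<Rightarrow> complex)"
  by unfold_locales
    (auto simp: cinner_simps scaleR_conv_of_real intro!: exI[of _ 1] cinner_cauchy_schwarz)

lemmas tendsto_cinner = bounded_bilinear.tendsto[OF bounded_bilinear_cinner]

lemma cinner_ext: "(\<And>z. cinner x z = cinner y z) \<Longrightarrow> x = (y::'a::complex_inner)"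
  using cinner_eq_zero_iff[of "x - y"] by (simp add: cinner_simps)

lemma tendsto_scaleC:
  "(X \<longlonglongrightarrow> x) \<Longrightarrow> (\<lambda>n. c *\<^sub>C X n) \<longlonglongrightarrow> c *\<^sub>C (x::'a::complex_inner)"
proof -
  have "bounded_linear (\<lambda>x::'a. c *\<^sub>C x)"
    by (rule bounded_linear_intro[of _ "cmod c"])
      (auto simp: scaleC_add_right scaleC_scaleR_commute norm_scaleC)
  then show "(X \<longlonglongrightarrow> x) \<Longrightarrow> ?thesis" by (rule bounded_linear.tendsto)
qed

text \<open>
  The first variation at a minimum is zero. Serves both for the Euler equation of the energy of a
  form and for the kernel of a non-negative operator.
\<close>

lemma linear_term_vanishes:
  fixes a b :: real
  assumes "\<And>t. 0 \<le> t\<^sup>2 * a + 2 * t * b"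
  shows "b = 0"
proof (rule ccontr)
  assume b: "b \<noteq> 0"
  define c where "c = \<bar>a\<bar> + 1"
  have c: "c > 0" "a < c" by (auto simp: c_def)
  \<comment> \<open>a small step against the sign of \<open>b\<close>; \<open>c > a\<close> makes the linear term win\<close>
  have "0 \<le> (- b / c)\<^sup>2 * a + 2 * (- b / c) * b" by (rule assms)
  also have "\<dots> = (b / c)\<^sup>2 * (a - 2 * c)" using c by (simp add: field_simps power2_eq_square)
  finally have "0 \<le> a - 2 * c" using b c by (simp add: zero_le_mult_iff)
  then show False using c by simp
qed

instance complex_hilbert \<subseteq> banach ..

section \<open>Closed forms\<close>

definition complex_subspace :: "'a::complex_vector set \<Rightarrow> bool" where
  "complex_subspace M \<longleftrightarrow>
     0 \<in> M \<and> (\<forall>x\<in>M. \<forall>y\<in>M. x + y \<in> M) \<and> (\<forall>c. \<forall>x\<in>M. c *\<^sub>C x \<in> M)"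

lemma complex_subspace_closure:
  fixes M :: "'a::complex_inner set"
  assumes M: "complex_subspace M"
  shows "complex_subspace (closure M)"
  unfolding complex_subspace_def
proof (intro conjI ballI allI)
  show "0 \<in> closure M"
    using M closure_subset unfolding complex_subspace_def by blast
next
  fix x y assume "x \<in> closure M" "y \<in> closure M"
  then obtain X Y where "\<And>n. X n \<in> M" "\<And>n. Y n \<in> M" "X \<longlonglongrightarrow> x" "Y \<longlonglongrightarrow> y"
    unfolding closure_sequential by blast
  then have "(\<forall>n. X n + Y n \<in> M) \<and> (\<lambda>n. X n + Y n) \<longlonglongrightarrow> x + y"
    using M unfolding complex_subspace_def by (auto intro: tendsto_add)
  then show "x + y \<in> closure M"
    unfolding closure_sequential by (intro exI[of _ "\<lambda>n. X n + Y n"])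
next
  fix c x assume "x \<in> closure M"
  then obtain X where "\<And>n. X n \<in> M" "X \<longlonglongrightarrow> x"
    unfolding closure_sequential by blast
  then have "(\<forall>n. c *\<^sub>C X n \<in> M) \<and> (\<lambda>n. c *\<^sub>C X n) \<longlonglongrightarrow> c *\<^sub>C x"
    using M unfolding complex_subspace_def by (auto intro: tendsto_scaleC)
  then show "c *\<^sub>C x \<in> closure M"
    unfolding closure_sequential by (intro exI[of _ "\<lambda>n. c *\<^sub>C X n"])
qed

text \<open>
  Non-negative hermitian forms, closed in the sense of lower semicontinuity: norm limits of sequences
  with bounded form values stay in the form domain and obey the same bound. This is all that
  the direct method of minimisation uses, and it avoids speaking of the form norm.
\<close>

locale closed_form =
  fixes D :: "'a::complex_hilbert set" and \<Omega> :: "'a \<Rightarrow> 'a \<Rightarrow> complex"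
  assumes subspace: "complex_subspace D"
    and form_add_left:
      "\<lbrakk>f \<in> D; g \<in> D; h \<in> D\<rbrakk> \<Longrightarrow> \<Omega> (f + g) h = \<Omega> f h + \<Omega> g h"
    and form_scaleC_left: "\<lbrakk>f \<in> D; g \<in> D\<rbrakk> \<Longrightarrow> \<Omega> (c *\<^sub>C f) g = c * \<Omega> f g"
    and form_commute: "\<lbrakk>f \<in> D; g \<in> D\<rbrakk> \<Longrightarrow> \<Omega> f g = cnj (\<Omega> g f)"
    and form_nonneg: "f \<in> D \<Longrightarrow> 0 \<le> Re (\<Omega> f f)"
    and form_closed:
      "\<lbrakk>\<And>n. X n \<in> D; X \<longlonglongrightarrow> f; \<And>n. Re (\<Omega> (X n) (X n)) \<le> b\<rbrakk>
        \<Longrightarrow> f \<in> D \<and> Re (\<Omega> f f) \<le> b"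
begin

lemma D_zero: "0 \<in> D"
  and D_add: "f \<in> D \<Longrightarrow> g \<in> D \<Longrightarrow> f + g \<in> D"
  and D_scaleC: "f \<in> D \<Longrightarrow> c *\<^sub>C f \<in> D"
  using subspace unfolding complex_subspace_def by auto

lemma D_scaleR: "f \<in> D \<Longrightarrow> r *\<^sub>R f \<in> D"
  by (simp add: scaleR_scaleC D_scaleC)

lemma D_diff: "f \<in> D \<Longrightarrow> g \<in> D \<Longrightarrow> f - g \<in> D"
  using D_add[of f "(-1) *\<^sub>C g"] D_scaleC[of g "-1"] by (simp add: scaleC_minus_one)

lemma form_add_right:
  "\<lbrakk>f \<in> D; g \<in> D; h \<in> D\<rbrakk> \<Longrightarrow> \<Omega> h (f + g) = \<Omega> h f + \<Omega> h g"
  by (metis form_add_left form_commute complex_cnj_add D_add)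

lemma form_scaleC_right: "\<lbrakk>f \<in> D; g \<in> D\<rbrakk> \<Longrightarrow> \<Omega> g (c *\<^sub>C f) = cnj c * \<Omega> g f"
  by (metis form_scaleC_left form_commute complex_cnj_mult D_scaleC)

lemma form_diff_left: "\<lbrakk>f \<in> D; g \<in> D; h \<in> D\<rbrakk> \<Longrightarrow> \<Omega> (f - g) h = \<Omega> f h - \<Omega> g h"
  using form_add_left[of f "(-1) *\<^sub>C g" h] form_scaleC_left[of g h "-1"] D_scaleC[of g "-1"]
  by (simp add: scaleC_minus_one)

lemma Re_form_add_scaleR:
  assumes "f \<in> D" "g \<in> D"
  shows "Re (\<Omega> (f + t *\<^sub>R g) (f + t *\<^sub>R g)) = Re (\<Omega> f f) + 2 * t * Re (\<Omega> f g) + t\<^sup>2 * Re (\<Omega> g g)"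
proof -
  have "Re (\<Omega> g f) = Re (\<Omega> f g)" using form_commute[OF assms] by simp
  then show ?thesis
    using assms by (simp add: scaleR_scaleC form_add_left form_add_right form_scaleC_left
        form_scaleC_right D_add D_scaleC power2_eq_square algebra_simps)
qed

text \<open>
  The minimiser of this functional over \<open>D\<close> is the solution \<open>f\<close> of \<open>f + T f = h\<close>, where \<open>T\<close> is the
  operator of the form.
\<close>

definition energy :: "'a \<Rightarrow> 'a \<Rightarrow> real" where
  "energy h f = (norm (f - h))\<^sup>2 + Re (\<Omega> f f)"

text \<open>
  Uniform convexity, by the parallelogram law for the norm and for the form. It makes every
  minimising sequence a Cauchy sequence.
\<close>

lemma energy_midpoint:
  assumes f: "f \<in> D" and g: "g \<in> D"
  shows "(norm (f - g))\<^sup>2 + 4 * energy h ((1/2) *\<^sub>R (f + g)) \<le> 2 * energy h f + 2 * energy h g"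
proof -
  let ?m = "(1/2) *\<^sub>R (f + g)"
  let ?d = "(1/2) *\<^sub>R (f - g)"
  have m: "?m \<in> D" and d: "?d \<in> D" using f g by (auto intro: D_scaleR D_add D_diff)
  have "?m + 1 *\<^sub>R ?d = f" "?m + (-1) *\<^sub>R ?d = g"
    by (simp_all add: algebra_simps flip: scaleR_add_left)
  then have q: "Re (\<Omega> f f) + Re (\<Omega> g g) = 2 * Re (\<Omega> ?m ?m) + 2 * Re (\<Omega> ?d ?d)"
    using Re_form_add_scaleR[OF m d, of 1] Re_form_add_scaleR[OF m d, of "-1"] by simp
  have "f - h = (?m - h) + ?d" "g - h = (?m - h) - ?d"
    by (simp_all add: algebra_simps flip: scaleR_add_left)
  then have "(norm (f - h))\<^sup>2 + (norm (g - h))\<^sup>2 = 2 * (norm (?m - h))\<^sup>2 + 2 * (norm ?d)\<^sup>2"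
    by (simp only: norm_add_sq[of "?m - h" ?d] norm_diff_sq[of "?m - h" ?d])
  moreover have "(norm (f - g))\<^sup>2 = 4 * (norm ?d)\<^sup>2" by (simp add: power_divide)
  ultimately show ?thesis using q form_nonneg[OF d] by (simp add: energy_def)
qed

lemma energy_minimizer:
  obtains f where "f \<in> D" "\<And>g. g \<in> D \<Longrightarrow> energy h f \<le> energy h g"
proof -
  define m where "m = Inf (energy h ` D)"
  have bdd: "bdd_below (energy h ` D)"
    by (rule bdd_belowI[of _ 0]) (auto simp: energy_def form_nonneg)
  have m_le: "m \<le> energy h g" if "g \<in> D" for g
    unfolding m_def using that bdd by (intro cInf_lower) auto
  have "\<exists>f\<in>D. energy h f < m + inverse (real (Suc n))" for n
  proof -
    have "energy h ` D \<noteq> {}" using D_zero by blast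
    moreover have "Inf (energy h ` D) < m + inverse (real (Suc n))"
      unfolding m_def by (simp del: of_nat_Suc)
    ultimately obtain z where "z \<in> energy h ` D" "z < m + inverse (real (Suc n))"
      by (rule cInf_lessD[THEN bexE])
    then show ?thesis by blast
  qed
  then obtain X where X: "\<And>n. X n \<in> D" "\<And>n. energy h (X n) < m + inverse (real (Suc n))"
    by metis
  have dist_le: "(norm (X i - X j))\<^sup>2 \<le> 2 * inverse (real (Suc i)) + 2 * inverse (real (Suc j))"
    for i j
    using energy_midpoint[OF X(1)[of i] X(1)[of j], of h] X(2)[of i] X(2)[of j]
      m_le[OF D_scaleR[OF D_add[OF X(1)[of i] X(1)[of j]]], of "1/2"] by linarith
  have "Cauchy X"
  proof (rule CauchyI)
    fix e :: real assume e: "e > 0"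
    obtain N where N: "inverse (real (Suc N)) < e\<^sup>2 / 4"
      using reals_Archimedean[of "e\<^sup>2 / 4"] e by auto
    have "norm (X i - X j) < e" if "i \<ge> N" "j \<ge> N" for i j
    proof -
      have "inverse (real (Suc i)) \<le> inverse (real (Suc N))"
        "inverse (real (Suc j)) \<le> inverse (real (Suc N))"
        using that by (auto intro!: le_imp_inverse_le)
      then have "(norm (X i - X j))\<^sup>2 < e\<^sup>2" using dist_le[of i j] N by linarith
      then show ?thesis using e by (simp add: power2_less_imp_less)
    qed
    then show "\<exists>M. \<forall>m\<ge>M. \<forall>n\<ge>M. norm (X m - X n) < e" by blast
  qed
  then obtain f where lim: "X \<longlonglongrightarrow> f" by (auto simp: Cauchy_convergent_iff convergent_def)
  let ?b = "m - (norm (f - h))\<^sup>2"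
  \<comment> \<open>the form values along \<open>X\<close> are eventually below \<open>?b + e\<close>, so semicontinuity applies to a tail\<close>
  have *: "f \<in> D \<and> Re (\<Omega> f f) \<le> ?b + e" if "e > 0" for e
  proof -
    have "(\<lambda>n. m + inverse (real (Suc n)) - (norm (X n - h))\<^sup>2) \<longlonglongrightarrow> m + 0 - (norm (f - h))\<^sup>2"
      by (intro tendsto_intros lim LIMSEQ_inverse_real_of_nat)
    then have "eventually (\<lambda>n. m + inverse (real (Suc n)) - (norm (X n - h))\<^sup>2 < ?b + e) sequentially"
      by (rule order_tendstoD(2)) (use that in linarith)
    then obtain N where N: "\<And>n. n \<ge> N \<Longrightarrow> m + inverse (real (Suc n)) - (norm (X n - h))\<^sup>2 < ?b + e"
      by (auto simp: eventually_sequentially)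
    have "Re (\<Omega> (X n) (X n)) \<le> ?b + e" if "n \<ge> N" for n
      using N[OF that] X(2)[of n] by (simp add: energy_def)
    then show ?thesis
      by (intro form_closed[of "\<lambda>n. X (n + N)" f] X(1) LIMSEQ_ignore_initial_segment[OF lim]) auto
  qed
  have "Re (\<Omega> f f) \<le> ?b" by (rule field_le_epsilon) (rule *[THEN conjunct2])
  then have "energy h f \<le> m" by (simp add: energy_def)
  then have "energy h f \<le> energy h g" if "g \<in> D" for g
    using m_le[OF that] by linarith
  moreover have "f \<in> D" using *[OF zero_less_one] by blast
  ultimately show ?thesis using that by blast
qed

text \<open>
  The Euler equation of the minimiser. Real variations give the real part of the equation, and
  the variation in direction \<open>\<i> g\<close> gives the imaginary part.
\<close>

lemma resolvent_exists: "\<exists>f\<in>D. \<forall>g\<in>D. cinner f g + \<Omega> f g = cinner h g"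
proof -
  obtain f where f: "f \<in> D" and min: "\<And>g. g \<in> D \<Longrightarrow> energy h f \<le> energy h g"
    using energy_minimizer by blast
  have re: "Re (cinner (f - h) g + \<Omega> f g) = 0" if g: "g \<in> D" for g
  proof (rule linear_term_vanishes)
    fix t :: real
    have "energy h f \<le> energy h (f + t *\<^sub>R g)"
      using f g by (intro min D_add D_scaleR)
    moreover have "(norm (f + t *\<^sub>R g - h))\<^sup>2
        = (norm (f - h))\<^sup>2 + 2 * t * Re (cinner (f - h) g) + t\<^sup>2 * (norm g)\<^sup>2"
      using norm_add_sq[of "f - h" "t *\<^sub>R g"]
      by (simp add: cinner_scaleR_right power_mult_distrib algebra_simps)
    ultimately show "0 \<le> t\<^sup>2 * ((norm g)\<^sup>2 + Re (\<Omega> g g)) + 2 * t * Re (cinner (f - h) g + \<Omega> f g)"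
      using Re_form_add_scaleR[OF f g, of t] by (simp add: energy_def algebra_simps)
  qed
  have "cinner f g + \<Omega> f g = cinner h g" if g: "g \<in> D" for g
  proof -
    have "Im (cinner (f - h) g + \<Omega> f g) = 0"
      using re[OF D_scaleC[OF g, of \<i>]] f g
      by (simp add: cinner_scaleC_right form_scaleC_right)
    with re[OF g] show ?thesis by (simp add: complex_eq_iff cinner_diff_left)
  qed
  with f show ?thesis by blast
qed

lemma resolvent_unique:
  assumes "f \<in> D" "f' \<in> D" "\<And>g. g \<in> D \<Longrightarrow> cinner f g + \<Omega> f g = cinner f' g + \<Omega> f' g"
  shows "f = f'"
proof -
  have d: "f - f' \<in> D" using assms(1,2) by (rule D_diff)
  have "cinner (f - f') (f - f') + \<Omega> (f - f') (f - f')
      = (cinner f (f - f') + \<Omega> f (f - f')) - (cinner f' (f - f') + \<Omega> f' (f - f'))"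
    unfolding cinner_diff_left[of f f'] form_diff_left[OF assms(1,2) d] by simp
  also have "\<dots> = 0" unfolding assms(3)[OF d] by simp
  finally have "Re (cinner (f - f') (f - f') + \<Omega> (f - f') (f - f')) = 0" by simp
  then have "Re (cinner (f - f') (f - f')) + Re (\<Omega> (f - f') (f - f')) = 0" by simp
  then have "(norm (f - f'))\<^sup>2 \<le> 0"
    using form_nonneg[OF d] by (simp only: Re_cinner_self)
  then show ?thesis by simp
qed

end

text \<open>
  For the zero form on the closure of \<open>M\<close>, the solution of the Euler equation is the orthogonal
  projection, so a vector outside the closure would leave a nonzero vector orthogonal to \<open>M\<close>.
\<close>

lemma dense_if_orthogonal_trivial:
  fixes M :: "'a::complex_hilbert set"
  assumes M: "complex_subspace M" and orth: "\<And>u. (\<And>g. g \<in> M \<Longrightarrow> cinner u g = 0) \<Longrightarrow> u = 0"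
  shows "closure M = UNIV"
proof -
  interpret closed_form "closure M" "\<lambda>_ _. 0"
  proof
    show "complex_subspace (closure M)" using M by (rule complex_subspace_closure)
    show "f \<in> closure M \<and> Re 0 \<le> b"
      if "\<And>n. X n \<in> closure M" "X \<longlonglongrightarrow> f" "\<And>n::nat. Re 0 \<le> b" for X f b
      using closed_sequentially[OF closed_closure that(1,2)] that(3) by blast
  qed simp_all
  have "h \<in> closure M" for h
  proof -
    obtain f where f: "f \<in> closure M" "\<And>g. g \<in> closure M \<Longrightarrow> cinner f g = cinner h g"
      using resolvent_exists[of h] by auto
    have "h - f = 0"
    proof (rule orth)
      fix g assume "g \<in> M"
      then have "g \<in> closure M" using closure_subset by (rule rev_subsetD)
      then show "cinner (h - f) g = 0" using f(2) by (simp add: cinner_diff_left)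
    qed
    with f(1) show ?thesis by simp
  qed
  then show ?thesis by blast
qed

section \<open>Bounded square roots\<close>

definition hermitian :: "('a::complex_inner \<Rightarrow>\<^sub>L 'a) \<Rightarrow> bool" where
  "hermitian A \<longleftrightarrow>
     (\<forall>x y. cinner (blinfun_apply A x) y = cinner x (blinfun_apply A y))"

lemma hermitianD:
  "hermitian A \<Longrightarrow> cinner (blinfun_apply A x) y = cinner x (blinfun_apply A y)"
  unfolding hermitian_def by blast

lemma hermitian_scaleC: "hermitian A \<Longrightarrow> blinfun_apply A (c *\<^sub>C x) = c *\<^sub>C blinfun_apply A x"
  by (rule cinner_ext) (simp add: hermitianD cinner_scaleC_left)

lemma hermitian_id: "hermitian id_blinfun"
  by (simp add: hermitian_def)

lemma hermitian_diff: "hermitian A \<Longrightarrow> hermitian B \<Longrightarrow> hermitian (A - B)"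
  by (simp add: hermitian_def blinfun.diff_left cinner_simps)

lemma hermitian_compose:
  assumes "hermitian A" "hermitian B" "A o\<^sub>L B = B o\<^sub>L A"
  shows "hermitian (A o\<^sub>L B)"
  unfolding hermitian_def
proof (intro allI)
  fix x y
  have "cinner (blinfun_apply (A o\<^sub>L B) x) y = cinner x (blinfun_apply (B o\<^sub>L A) y)"
    by (simp add: hermitianD[OF assms(1)] hermitianD[OF assms(2)])
  then show "cinner (blinfun_apply (A o\<^sub>L B) x) y = cinner x (blinfun_apply (A o\<^sub>L B) y)"
    using assms by simp
qed

lemma commutes_id_minus:
  assumes "Z o\<^sub>L A = A o\<^sub>L Z"
  shows "Z o\<^sub>L (id_blinfun - A) = (id_blinfun - A) o\<^sub>L Z"
proof (rule blinfun_eqI)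
  fix v
  have "blinfun_apply (Z o\<^sub>L A) v = blinfun_apply (A o\<^sub>L Z) v" using assms by simp
  then show "blinfun_apply (Z o\<^sub>L (id_blinfun - A)) v = blinfun_apply ((id_blinfun - A) o\<^sub>L Z) v"
    by (simp add: blinfun.bilinear_simps)
qed

text \<open>
  Symmetry with respect to a definite inner product already forces additivity and homogeneity.
\<close>

lemma hermitian_blinfunI:
  fixes f :: "'a::complex_inner \<Rightarrow> 'a"
  assumes sym: "\<And>x y. cinner (f x) y = cinner x (f y)" and bnd: "\<And>x. norm (f x) \<le> norm x"
  obtains A where "hermitian A" "blinfun_apply A = f" "norm A \<le> 1"
proof -
  have "bounded_linear f"
  proof (rule bounded_linear_intro[of _ 1])
    show "f (x + y) = f x + f y" for x y by (rule cinner_ext) (simp add: sym cinner_add_left)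
    show "f (r *\<^sub>R x) = r *\<^sub>R f x" for r x
      by (rule cinner_ext) (simp add: sym cinner_scaleR_left)
    show "norm (f x) \<le> norm x * 1" for x using bnd by simp
  qed
  then have A: "blinfun_apply (Blinfun f) = f" by (rule bounded_linear_Blinfun_apply)
  show ?thesis
  proof (rule that[of "Blinfun f"])
    show "hermitian (Blinfun f)" unfolding hermitian_def A using sym by blast
    show "norm (Blinfun f) \<le> 1" by (rule norm_blinfun_bound) (simp_all add: A bnd)
  qed (rule A)
qed

text \<open>
  Non-negativity is carried around in this form because it is an estimate on the operator norm, which
  survives limits of operators and is the starting point of the square root iteration.
\<close>

lemma nonneg_if_norm_id_minus:
  assumes "norm (id_blinfun - B) \<le> 1"
  shows "0 \<le> Re (cinner (blinfun_apply B x) (x::'a::complex_inner))"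
proof -
  have "norm (x - blinfun_apply B x) \<le> norm x"
    using norm_blinfun[of "id_blinfun - B" x] mult_right_mono[OF assms norm_ge_zero[of x]]
    by (simp add: blinfun.diff_left)
  then have "norm (x - blinfun_apply B x) * norm x \<le> (norm x)\<^sup>2"
    unfolding power2_eq_square by (rule mult_right_mono) simp
  then have "Re (cinner (x - blinfun_apply B x) x) \<le> (norm x)\<^sup>2"
    using Re_cinner_le[of "x - blinfun_apply B x" x] by linarith
  then show ?thesis by (simp add: cinner_diff_left Re_cinner_self)
qed

text \<open>
  With \<open>Y = 1 - B\<close> and \<open>X = 1 - R\<close>, the equation \<open>B\<^sup>2 = R\<close> becomes the fixed point equation
  \<open>Y = (X + Y\<^sup>2) / 2\<close>. Its iteration from \<open>0\<close> consists of polynomials in \<open>X\<close> with non-negative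
  coefficients, so for \<open>\<parallel>X\<parallel> \<le> 1\<close> it is dominated in norm by the same iteration for the number \<open>1\<close>.
\<close>

fun sqrt_iter :: "('a::real_normed_vector \<Rightarrow>\<^sub>L 'a) \<Rightarrow> nat \<Rightarrow> 'a \<Rightarrow>\<^sub>L 'a" where
  "sqrt_iter X 0 = 0"
| "sqrt_iter X (Suc n) = (1/2) *\<^sub>R (X + (sqrt_iter X n o\<^sub>L sqrt_iter X n))"

fun sqrt_majorant :: "nat \<Rightarrow> real" where
  "sqrt_majorant 0 = 0"
| "sqrt_majorant (Suc n) = (1 + (sqrt_majorant n)\<^sup>2) / 2"

lemma sqrt_majorant_bounds: "0 \<le> sqrt_majorant n \<and> sqrt_majorant n \<le> 1"
proof (induction n)
  case (Suc n)
  then have "(sqrt_majorant n)\<^sup>2 \<le> 1" by (simp add: power_le_one)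
  then show ?case by simp
qed simp

text \<open>
  The increments are \<open>(1 - t)\<^sup>2 / 2 \<ge> 0\<close>, where \<open>t\<close> is the current value.
\<close>

lemma sqrt_majorant_convergent: "convergent sqrt_majorant"
proof (rule Bseq_mono_convergent)
  show "Bseq sqrt_majorant"
    by (rule BseqI'[of _ 1]) (simp add: sqrt_majorant_bounds)
  have "sqrt_majorant n \<le> sqrt_majorant (Suc n)" for n
    using zero_le_power2[of "sqrt_majorant n - 1"] by (simp add: power2_diff field_simps)
  then show "\<forall>m n. m \<le> n \<longrightarrow> sqrt_majorant m \<le> sqrt_majorant n"
    by (simp add: lift_Suc_mono_le)
qed

lemma norm_sqrt_iter_le:
  assumes "norm X \<le> 1"
  shows "norm (sqrt_iter X n) \<le> sqrt_majorant n"
proof (induction n)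
  case (Suc n)
  have "norm (sqrt_iter X n o\<^sub>L sqrt_iter X n) \<le> sqrt_majorant n * sqrt_majorant n"
    by (rule order_trans[OF norm_blinfun_compose])
      (intro mult_mono Suc norm_ge_zero conjunct1[OF sqrt_majorant_bounds])
  then have "norm (X + (sqrt_iter X n o\<^sub>L sqrt_iter X n)) \<le> 1 + (sqrt_majorant n)\<^sup>2"
    using assms by (intro norm_triangle_le) (simp add: power2_eq_square field_simps power4_eq_xxxx)
  then show ?case by simp
qed simp

text \<open>
  Factor the difference of squares as \<open>P\<^sup>2 - Q\<^sup>2 = P (P - Q) + (P - Q) Q\<close> and compare with
  \<open>p\<^sup>2 - q\<^sup>2\<close>. Since the majorant converges, the telescoped estimate makes the iteration Cauchy
  even when \<open>\<parallel>X\<parallel> = 1\<close>, where no geometric rate is available.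
\<close>

lemma norm_sqrt_iter_step_le:
  assumes "norm X \<le> 1"
  shows "norm (sqrt_iter X (Suc n) - sqrt_iter X n) \<le> sqrt_majorant (Suc n) - sqrt_majorant n"
proof (induction n)
  case 0
  show ?case using assms by simp
next
  case (Suc n)
  let ?P = "sqrt_iter X (Suc n)" and ?Q = "sqrt_iter X n"
  let ?p = "sqrt_majorant (Suc n)" and ?q = "sqrt_majorant n"
  have nn: "0 \<le> ?p" "0 \<le> ?q" using sqrt_majorant_bounds by blast+
  have pq: "0 \<le> ?p - ?q" using Suc norm_ge_zero order_trans by blast
  have "sqrt_iter X (Suc (Suc n)) - ?P = (1/2) *\<^sub>R ((?P o\<^sub>L ?P) - (?Q o\<^sub>L ?Q))"
    by (simp add: scaleR_diff_right scaleR_add_right)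
  also have "(?P o\<^sub>L ?P) - (?Q o\<^sub>L ?Q) = (?P o\<^sub>L (?P - ?Q)) + ((?P - ?Q) o\<^sub>L ?Q)"
    by (rule blinfun_eqI) (simp add: blinfun.bilinear_simps del: sqrt_iter.simps)
  finally have eq: "sqrt_iter X (Suc (Suc n)) - ?P
      = (1/2) *\<^sub>R ((?P o\<^sub>L (?P - ?Q)) + ((?P - ?Q) o\<^sub>L ?Q))" .
  have "norm (?P o\<^sub>L (?P - ?Q)) \<le> ?p * (?p - ?q)"
    by (rule order_trans[OF norm_blinfun_compose])
      (intro mult_mono norm_sqrt_iter_le[OF assms] Suc.IH norm_ge_zero nn)
  moreover have "norm ((?P - ?Q) o\<^sub>L ?Q) \<le> (?p - ?q) * ?q"
    by (rule order_trans[OF norm_blinfun_compose])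
      (intro mult_mono norm_sqrt_iter_le[OF assms] Suc.IH norm_ge_zero pq)
  ultimately have "norm ((?P o\<^sub>L (?P - ?Q)) + ((?P - ?Q) o\<^sub>L ?Q)) \<le> ?p * (?p - ?q) + (?p - ?q) * ?q"
    by (intro norm_triangle_le add_mono)
  moreover have "?p * (?p - ?q) + (?p - ?q) * ?q = ?p\<^sup>2 - ?q\<^sup>2"
    by (simp add: power2_eq_square algebra_simps del: sqrt_majorant.simps)
  ultimately have "norm (sqrt_iter X (Suc (Suc n)) - ?P) \<le> (?p\<^sup>2 - ?q\<^sup>2) / 2"
    unfolding eq by (simp del: sqrt_iter.simps sqrt_majorant.simps)
  also have "\<dots> = sqrt_majorant (Suc (Suc n)) - ?p"
    by (simp add: field_simps)
  finally show ?case .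
qed

lemma sqrt_iter_hermitian_commutes:
  assumes "hermitian X"
  shows "hermitian (sqrt_iter X n)"
    and "Z o\<^sub>L X = X o\<^sub>L Z \<Longrightarrow> Z o\<^sub>L sqrt_iter X n = sqrt_iter X n o\<^sub>L Z"
proof -
  show "hermitian (sqrt_iter X n)"
    by (induction n) (use assms in \<open>simp_all add: hermitian_def blinfun.bilinear_simps cinner_simps\<close>)
  assume Z: "Z o\<^sub>L X = X o\<^sub>L Z"
  show "Z o\<^sub>L sqrt_iter X n = sqrt_iter X n o\<^sub>L Z"
  proof (induction n)
    case (Suc n)
    have X: "blinfun_apply Z (blinfun_apply X v) = blinfun_apply X (blinfun_apply Z v)" for v
      using Z by (metis blinfun_apply_blinfun_compose)
    have Y: "blinfun_apply Z (blinfun_apply (sqrt_iter X n) v)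
        = blinfun_apply (sqrt_iter X n) (blinfun_apply Z v)" for v
      using Suc by (metis blinfun_apply_blinfun_compose)
    show ?case by (rule blinfun_eqI) (simp add: blinfun.bilinear_simps X Y)
  qed (auto intro: blinfun_eqI)
qed

text \<open>
  The commutation clause lets roots of commuting operators be multiplied, and it replaces the
  functional calculus in what follows.
\<close>

lemma bounded_sqrt:
  fixes R :: "'a::complex_hilbert \<Rightarrow>\<^sub>L 'a"
  assumes R: "hermitian R" and bnd: "norm (id_blinfun - R) \<le> 1"
  obtains B where "hermitian B" "norm (id_blinfun - B) \<le> 1" "B o\<^sub>L B = R"
    "\<And>Z. Z o\<^sub>L R = R o\<^sub>L Z \<Longrightarrow> Z o\<^sub>L B = B o\<^sub>L Z"
proof -
  define X where "X = id_blinfun - R"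
  have X: "hermitian X" "norm X \<le> 1" using assms by (auto simp: X_def hermitian_diff hermitian_id)
  have tel: "norm (sqrt_iter X n - sqrt_iter X m) \<le> sqrt_majorant n - sqrt_majorant m"
    if "m \<le> n" for m n
    using that
  proof (induction n rule: dec_induct)
    case (step n)
    have "norm (sqrt_iter X (Suc n) - sqrt_iter X m)
        \<le> norm (sqrt_iter X (Suc n) - sqrt_iter X n) + norm (sqrt_iter X n - sqrt_iter X m)"
      using norm_triangle_ineq[of "sqrt_iter X (Suc n) - sqrt_iter X n" "sqrt_iter X n - sqrt_iter X m"]
      by (simp del: sqrt_iter.simps)
    then show ?case using norm_sqrt_iter_step_le[OF X(2), of n] step.IH by linarith
  qed simp
  have "Cauchy (sqrt_iter X)"
  proof (rule CauchyI')
    fix e :: real assume "e > 0"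
    then obtain M where M: "\<And>m n. m \<ge> M \<Longrightarrow> n \<ge> M \<Longrightarrow> norm (sqrt_majorant m - sqrt_majorant n) < e"
      using CauchyD[OF convergent_Cauchy[OF sqrt_majorant_convergent]] by metis
    have "dist (sqrt_iter X m) (sqrt_iter X n) < e" if "m \<ge> M" "n > m" for m n
      using tel[of m n] M[of n m] that by (simp add: dist_norm norm_minus_commute)
    then show "\<exists>M. \<forall>m\<ge>M. \<forall>n>m. dist (sqrt_iter X m) (sqrt_iter X n) < e" by blast
  qed
  then obtain Y where Y: "sqrt_iter X \<longlonglongrightarrow> Y" by (auto simp: Cauchy_convergent_iff convergent_def)
  have pt: "(\<lambda>n. blinfun_apply (sqrt_iter X n) v) \<longlonglongrightarrow> blinfun_apply Y v" for v
    by (intro blinfun.tendsto Y tendsto_const)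
  have hermY: "hermitian Y"
    unfolding hermitian_def
  proof (intro allI)
    fix x y
    have "(\<lambda>n. cinner (blinfun_apply (sqrt_iter X n) x) y) \<longlonglongrightarrow> cinner (blinfun_apply Y x) y"
      by (intro tendsto_cinner pt tendsto_const)
    moreover have "(\<lambda>n. cinner (blinfun_apply (sqrt_iter X n) x) y) \<longlonglongrightarrow> cinner x (blinfun_apply Y y)"
      unfolding hermitianD[OF sqrt_iter_hermitian_commutes(1)[OF X(1)]]
      by (intro tendsto_cinner pt tendsto_const)
    ultimately show "cinner (blinfun_apply Y x) y = cinner x (blinfun_apply Y y)"
      by (rule LIMSEQ_unique)
  qed
  have normY: "norm Y \<le> 1"
    by (rule tendsto_upperbound[OF tendsto_norm[OF Y]])
      (auto intro!: always_eventually order_trans[OF norm_sqrt_iter_le[OF X(2)]]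
        simp: sqrt_majorant_bounds)
  have commY: "Z o\<^sub>L Y = Y o\<^sub>L Z" if Z: "Z o\<^sub>L X = X o\<^sub>L Z" for Z
  proof (rule LIMSEQ_unique)
    show "(\<lambda>n. Z o\<^sub>L sqrt_iter X n) \<longlonglongrightarrow> (Z o\<^sub>L Y)"
      by (intro bounded_bilinear.tendsto[OF bounded_bilinear_blinfun_compose] Y tendsto_const)
    show "(\<lambda>n. Z o\<^sub>L sqrt_iter X n) \<longlonglongrightarrow> (Y o\<^sub>L Z)"
      unfolding sqrt_iter_hermitian_commutes(2)[OF X(1) Z]
      by (intro bounded_bilinear.tendsto[OF bounded_bilinear_blinfun_compose] Y tendsto_const)
  qed
  have fix_eq: "Y = (1/2) *\<^sub>R (X + (Y o\<^sub>L Y))"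
  proof (rule LIMSEQ_unique)
    show "(\<lambda>n. sqrt_iter X (Suc n)) \<longlonglongrightarrow> Y" using Y by (rule LIMSEQ_Suc)
    show "(\<lambda>n. sqrt_iter X (Suc n)) \<longlonglongrightarrow> (1/2) *\<^sub>R (X + (Y o\<^sub>L Y))"
      unfolding sqrt_iter.simps
      by (intro tendsto_intros bounded_bilinear.tendsto[OF bounded_bilinear_blinfun_compose] Y)
  qed
  have sq: "(id_blinfun - Y) o\<^sub>L (id_blinfun - Y) = R"
  proof (rule blinfun_eqI)
    fix v
    have "2 *\<^sub>R Y = X + (Y o\<^sub>L Y)" by (subst fix_eq) simp
    then have "blinfun_apply (2 *\<^sub>R Y) v = blinfun_apply (X + (Y o\<^sub>L Y)) v" by simp
    then have "2 *\<^sub>R blinfun_apply Y v = v - blinfun_apply R v + blinfun_apply Y (blinfun_apply Y v)"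
      by (simp add: X_def blinfun.bilinear_simps)
    then show "blinfun_apply ((id_blinfun - Y) o\<^sub>L (id_blinfun - Y)) v = blinfun_apply R v"
      by (simp add: blinfun.bilinear_simps scaleR_2 algebra_simps)
  qed
  show ?thesis
  proof (rule that[of "id_blinfun - Y"])
    show "hermitian (id_blinfun - Y)" by (simp add: hermY hermitian_diff hermitian_id)
    show "norm (id_blinfun - (id_blinfun - Y)) \<le> 1" using normY by simp
    show "(id_blinfun - Y) o\<^sub>L (id_blinfun - Y) = R" by (rule sq)
    show "Z o\<^sub>L (id_blinfun - Y) = (id_blinfun - Y) o\<^sub>L Z" if "Z o\<^sub>L R = R o\<^sub>L Z" for Z
      using that unfolding X_def by (intro commutes_id_minus commY) (simp add: X_def commutes_id_minus)
  qed
qed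

section \<open>The resolvent of a closed form\<close>

text \<open>
  Testing the weak equation with the solution itself gives \<open>\<parallel>R h\<parallel>\<^sup>2 \<le> Re \<langle>h|R h\<rangle>\<close>, from which both
  norm bounds follow. The hermitian symmetry of \<open>R\<close> is that of the form.
\<close>

lemma (in closed_form) resolvent:
  obtains R where "hermitian R" "norm R \<le> 1" "norm (id_blinfun - R) \<le> 1"
    "\<And>h. blinfun_apply R h \<in> D"
    "\<And>h g. g \<in> D \<Longrightarrow> cinner (blinfun_apply R h) g + \<Omega> (blinfun_apply R h) g = cinner h g"
proof -
  obtain r where rD: "\<And>h. r h \<in> D"
    and r: "\<And>h g. g \<in> D \<Longrightarrow> cinner (r h) g + \<Omega> (r h) g = cinner h g"
    using resolvent_exists by metis
  have sym: "cinner (r x) y = cinner x (r y)" for x y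
  proof -
    have "cinner (r x) y = cnj (cinner y (r x))" by (rule cinner_commute)
    also have "\<dots> = cnj (cinner (r y) (r x)) + cnj (\<Omega> (r y) (r x))"
      by (subst r[OF rD, symmetric]) simp
    also have "\<dots> = cinner (r x) (r y) + \<Omega> (r x) (r y)"
      by (simp only: cinner_commute[of "r y" "r x"] form_commute[OF rD rD, of y x] complex_cnj_cnj)
    finally show ?thesis by (simp only: r[OF rD])
  qed
  have sq: "(norm (r h))\<^sup>2 \<le> Re (cinner h (r h))" for h
    using form_nonneg[OF rD[of h]] by (subst r[OF rD, symmetric]) (simp add: Re_cinner_self)
  have bnd: "norm (r h) \<le> norm h" for h
  proof (cases "r h = 0")
    case False
    have "norm (r h) * norm (r h) \<le> norm h * norm (r h)"
      using sq[of h] Re_cinner_le[of h "r h"] unfolding power2_eq_square by linarith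
    with False show ?thesis by simp
  qed simp
  obtain R where R: "hermitian R" "blinfun_apply R = r" "norm R \<le> 1"
    using hermitian_blinfunI[OF sym bnd] by blast
  have "norm (id_blinfun - R) \<le> 1"
  proof (rule norm_blinfun_bound)
    fix h
    have "(norm (h - r h))\<^sup>2 \<le> (norm h)\<^sup>2"
      using sq[of h] zero_le_power2[of "norm (r h)"] unfolding norm_diff_sq by linarith
    then have "norm (h - r h) \<le> norm h" by (rule power2_le_imp_le) simp
    then show "norm (blinfun_apply (id_blinfun - R) h) \<le> 1 * norm h"
      by (simp add: blinfun.diff_left R(2))
  qed simp
  then show ?thesis using that[of R] R rD r by simp
qed

text \<open>
  Kato's representation theorem in resolvent form: \<open>T = R\<^sup>-\<^sup>1 - 1\<close>.
\<close>

lemma (in closed_form) form_operator_eq_range: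
  assumes RD: "\<And>h. blinfun_apply R h \<in> D"
    and R: "\<And>h g. g \<in> D \<Longrightarrow> cinner (blinfun_apply R h) g + \<Omega> (blinfun_apply R h) g = cinner h g"
  shows "form_operator D \<Omega> = range (\<lambda>u. (blinfun_apply R u, u - blinfun_apply R u))"
proof (intro equalityI subsetI)
  fix p assume "p \<in> form_operator D \<Omega>"
  then obtain f h where p: "p = (f, h)" and f: "f \<in> D" and h: "\<And>g. g \<in> D \<Longrightarrow> \<Omega> f g = cinner h g"
    unfolding form_operator_def by blast
  have "blinfun_apply R (f + h) = f"
    by (rule resolvent_unique[OF RD f]) (simp add: R h cinner_add_left)
  then have "p = (blinfun_apply R (f + h), (f + h) - blinfun_apply R (f + h))" by (simp add: p)
  then show "p \<in> range (\<lambda>u. (blinfun_apply R u, u - blinfun_apply R u))" by (rule range_eqI)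
next
  fix p assume "p \<in> range (\<lambda>u. (blinfun_apply R u, u - blinfun_apply R u))"
  then obtain u where p: "p = (blinfun_apply R u, u - blinfun_apply R u)" by blast
  have "\<Omega> (blinfun_apply R u) g = cinner (u - blinfun_apply R u) g" if "g \<in> D" for g
    using R[OF that, of u] by (simp add: cinner_diff_left algebra_simps)
  then show "p \<in> form_operator D \<Omega>" by (simp add: p form_operator_def RD)
qed

section \<open>Self-adjoint operators\<close>

lemma self_adjoint_symmetric:
  assumes "self_adjoint S" "(f, h) \<in> S" "(g, k) \<in> S"
  shows "cinner h g = cinner f k"
proof -
  have "(g, k) \<in> adjoint_op S" using assms by (simp add: self_adjoint_def)
  then show ?thesis using assms(2) unfolding adjoint_op_def by blast
qed

text \<open>
  Self-adjoint operators are maximal symmetric, as passing to adjoints reverses inclusions.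
\<close>

lemma self_adjoint_eqI:
  assumes "self_adjoint S" "self_adjoint S'" "S \<subseteq> S'"
  shows "S = S'"
proof -
  have "adjoint_op S' \<subseteq> adjoint_op S" using assms(3) unfolding adjoint_op_def by blast
  then show ?thesis using assms unfolding self_adjoint_def by auto
qed

lemma linear_operator_diff:
  assumes "linear_operator T" "(f, h) \<in> T" "(g, k) \<in> T"
  shows "(f - g, h - k) \<in> T"
proof -
  have "((-1) *\<^sub>C g, (-1) *\<^sub>C k) \<in> T" using assms unfolding linear_operator_def by blast
  then have "(f + (-1) *\<^sub>C g, h + (-1) *\<^sub>C k) \<in> T"
    using assms unfolding linear_operator_def by blast
  then show ?thesis by (simp add: scaleC_minus_one)
qed

lemma Re_nonneg_op: "nonneg_op S \<Longrightarrow> (f, h) \<in> S \<Longrightarrow> 0 \<le> Re (cinner h f)"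
  unfolding nonneg_op_def by (auto simp: complex_nonneg_Reals_iff)

lemma complex_subspace_range:
  assumes "hermitian A"
  shows "complex_subspace (range (blinfun_apply A))"
  unfolding complex_subspace_def
proof (intro conjI ballI allI)
  show "0 \<in> range (blinfun_apply A)" by (rule range_eqI[of _ _ 0]) simp
  show "x + y \<in> range (blinfun_apply A)"
    if "x \<in> range (blinfun_apply A)" "y \<in> range (blinfun_apply A)" for x y
    using that by (auto simp flip: blinfun.add_right)
  show "c *\<^sub>C x \<in> range (blinfun_apply A)" if "x \<in> range (blinfun_apply A)" for c x
    using that by (auto simp flip: hermitian_scaleC[OF assms])
qed

lemma hermitian_injective_range_dense:
  fixes A :: "'a::complex_hilbert \<Rightarrow>\<^sub>L 'a"
  assumes A: "hermitian A" and inj: "\<And>x. blinfun_apply A x = 0 \<Longrightarrow> x = 0"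
  shows "closure (range (blinfun_apply A)) = UNIV"
proof (rule dense_if_orthogonal_trivial[OF complex_subspace_range[OF A]])
  fix u assume u: "\<And>g. g \<in> range (blinfun_apply A) \<Longrightarrow> cinner u g = 0"
  have "cinner (blinfun_apply A u) (blinfun_apply A u) = 0"
    using u[of "blinfun_apply A (blinfun_apply A u)"] by (simp add: hermitianD[OF A])
  then show "u = 0" by (simp add: cinner_eq_zero_iff inj)
qed

section \<open>Square roots of unbounded operators\<close>

text \<open>
  A zero of the quadratic form \<open>\<langle>P y|y\<rangle> \<ge> 0\<close> is a minimum, so its first variation in the direction
  \<open>P y\<close>, which is twice \<open>\<parallel>P y\<parallel>\<^sup>2\<close>, vanishes there.
\<close>

lemma hermitian_nonneg_kernel:
  assumes P: "hermitian P" and nn: "\<And>x. 0 \<le> Re (cinner (blinfun_apply P x) x)"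
    and y: "Re (cinner (blinfun_apply P y) y) = 0"
  shows "blinfun_apply P y = 0"
proof -
  let ?z = "blinfun_apply P y"
  have "Re (cinner ?z ?z) = 0"
  proof (rule linear_term_vanishes)
    fix t :: real
    have "0 \<le> Re (cinner (blinfun_apply P (y + t *\<^sub>R ?z)) (y + t *\<^sub>R ?z))" by (rule nn)
    also have "\<dots> = Re (cinner ?z y) + t * Re (cinner ?z ?z) + t * Re (cinner (blinfun_apply P ?z) y)
        + t\<^sup>2 * Re (cinner (blinfun_apply P ?z) ?z)"
      by (simp add: blinfun.bilinear_simps cinner_simps power2_eq_square algebra_simps)
    also have "cinner (blinfun_apply P ?z) y = cinner ?z ?z" by (rule hermitianD[OF P])
    finally show "0 \<le> t\<^sup>2 * Re (cinner (blinfun_apply P ?z) ?z) + 2 * t * Re (cinner ?z ?z)"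
      using y by simp
  qed
  then show ?thesis by (simp add: Re_cinner_self)
qed

text \<open>
  For \<open>y = (P - Q) x\<close> one has \<open>(P + Q) y = (P\<^sup>2 - Q\<^sup>2) x = 0\<close>. Hence the non-negative numbers
  \<open>\<langle>P y|y\<rangle>\<close> and \<open>\<langle>Q y|y\<rangle>\<close> are both zero, \<open>P y = Q y = 0\<close>, and
  \<open>\<parallel>y\<parallel>\<^sup>2 = \<langle>x|(P - Q) y\<rangle> = 0\<close>.
\<close>

lemma hermitian_nonneg_sqrt_unique:
  assumes P: "hermitian P" and Q: "hermitian Q"
    and Pnn: "\<And>x. 0 \<le> Re (cinner (blinfun_apply P x) x)"
    and Qnn: "\<And>x. 0 \<le> Re (cinner (blinfun_apply Q x) x)"
    and sq: "\<And>x. blinfun_apply P (blinfun_apply P x) = blinfun_apply Q (blinfun_apply Q x)"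
    and comm: "\<And>x. blinfun_apply P (blinfun_apply Q x) = blinfun_apply Q (blinfun_apply P x)"
  shows "P = Q"
proof (rule blinfun_eqI)
  fix x
  let ?y = "blinfun_apply P x - blinfun_apply Q x"
  have "blinfun_apply P ?y + blinfun_apply Q ?y = 0"
    by (simp add: blinfun.diff_right sq comm)
  then have "cinner (blinfun_apply P ?y + blinfun_apply Q ?y) ?y = 0" by simp
  then have "Re (cinner (blinfun_apply P ?y) ?y) + Re (cinner (blinfun_apply Q ?y) ?y) = 0"
    unfolding cinner_add_left by (simp only: plus_complex.sel(1)[symmetric]) simp
  then have "Re (cinner (blinfun_apply P ?y) ?y) = 0" "Re (cinner (blinfun_apply Q ?y) ?y) = 0"
    using Pnn[of ?y] Qnn[of ?y] by linarith+
  then have "blinfun_apply P ?y = 0" "blinfun_apply Q ?y = 0"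
    using hermitian_nonneg_kernel[OF P Pnn] hermitian_nonneg_kernel[OF Q Qnn] by blast+
  moreover have "cinner ?y ?y = cinner x (blinfun_apply P ?y) - cinner x (blinfun_apply Q ?y)"
    by (simp only: cinner_diff_left hermitianD[OF P] hermitianD[OF Q])
  ultimately have "cinner ?y ?y = 0" by simp
  then show "blinfun_apply P x = blinfun_apply Q x" by (simp add: cinner_eq_zero_iff)
qed

text \<open>
  Commuting hermitian \<open>A\<close> and \<open>B\<close> with \<open>A\<^sup>2 + B\<^sup>2 = 1\<close> parametrise the graph of the unbounded
  operator \<open>A B\<^sup>-\<^sup>1\<close> by \<open>x \<mapsto> (B x, A x)\<close>, as cosine and sine parametrise a line of given slope.
\<close>

locale cosine_sine_pair =
  fixes A B :: "'a::complex_hilbert \<Rightarrow>\<^sub>L 'a"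
  assumes A: "hermitian A" and B: "hermitian B"
    and comm: "blinfun_apply A (blinfun_apply B x) = blinfun_apply B (blinfun_apply A x)"
    and sum_squares: "blinfun_apply A (blinfun_apply A x) + blinfun_apply B (blinfun_apply B x) = x"
    and inj: "blinfun_apply B x = 0 \<Longrightarrow> x = 0"
    and nonneg: "0 \<le> Re (cinner (blinfun_apply A (blinfun_apply B x)) x)"
begin

definition quotient :: "('a \<times> 'a) set" where
  "quotient = range (\<lambda>x. (blinfun_apply B x, blinfun_apply A x))"

lemma quotientI: "(blinfun_apply B x, blinfun_apply A x) \<in> quotient"
  unfolding quotient_def by (rule rangeI)

text \<open>
  The pair \<open>(B x, A x)\<close> determines its parameter as \<open>x = B g + A h\<close>.
\<close>

lemma quotient_iff: "(g, h) \<in> quotient \<longleftrightarrow> blinfun_apply A g = blinfun_apply B h"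
proof
  assume "(g, h) \<in> quotient"
  then show "blinfun_apply A g = blinfun_apply B h" by (auto simp: quotient_def comm)
next
  assume eq: "blinfun_apply A g = blinfun_apply B h"
  let ?x = "blinfun_apply B g + blinfun_apply A h"
  have "blinfun_apply B ?x = g"
    using sum_squares[of g] by (simp add: blinfun.add_right eq add.commute flip: comm)
  moreover have "blinfun_apply A ?x = h"
    using sum_squares[of h] by (simp add: blinfun.add_right eq comm add.commute)
  ultimately show "(g, h) \<in> quotient" using quotientI[of ?x] by simp
qed

text \<open>
  Membership of \<open>(g, h)\<close> in the adjoint says \<open>\<langle>A x|g\<rangle> = \<langle>B x|h\<rangle>\<close> for all \<open>x\<close>. Moving \<open>A\<close> and \<open>B\<close> to the
  other side turns this into the equation \<open>A g = B h\<close> of the graph itself.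
\<close>

lemma adjoint_quotient: "adjoint_op quotient = quotient"
proof -
  have "(g, h) \<in> adjoint_op quotient \<longleftrightarrow> blinfun_apply A g = blinfun_apply B h" for g h
  proof
    assume "(g, h) \<in> adjoint_op quotient"
    then have *: "cinner (blinfun_apply A x) g = cinner (blinfun_apply B x) h" for x
      unfolding adjoint_op_def using quotientI[of x] by blast
    show "blinfun_apply A g = blinfun_apply B h"
    proof (rule cinner_ext)
      fix z
      have "cinner z (blinfun_apply A g) = cinner z (blinfun_apply B h)"
        using *[of z] by (simp only: hermitianD[OF A] hermitianD[OF B])
      then show "cinner (blinfun_apply A g) z = cinner (blinfun_apply B h) z"
        by (metis cinner_commute)
    qed
  next
    assume "blinfun_apply A g = blinfun_apply B h"
    then show "(g, h) \<in> adjoint_op quotient"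
      by (auto simp: adjoint_op_def quotient_def hermitianD[OF A] hermitianD[OF B])
  qed
  then show ?thesis by (auto simp: quotient_iff)
qed

lemma self_adjoint_quotient: "self_adjoint quotient"
proof -
  have "linear_operator quotient"
    unfolding linear_operator_def
  proof (intro conjI allI)
    show "(0, 0) \<in> quotient" by (simp add: quotient_iff)
    show "\<forall>(f, h)\<in>quotient. \<forall>(g, k)\<in>quotient. (f + g, h + k) \<in> quotient"
      by (auto simp: quotient_iff blinfun.add_right)
    show "\<forall>(f, h)\<in>quotient. (c *\<^sub>C f, c *\<^sub>C h) \<in> quotient" for c
      by (auto simp: quotient_iff hermitian_scaleC[OF A] hermitian_scaleC[OF B])
    show "single_valued quotient"
    proof (rule single_valuedI)
      fix f h k assume "(f, h) \<in> quotient" "(f, k) \<in> quotient"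
      then have "blinfun_apply B (h - k) = 0" by (simp add: quotient_iff blinfun.diff_right)
      then show "h = k" using inj by fastforce
    qed
  qed
  moreover have "Domain quotient = range (blinfun_apply B)" by (auto simp: quotient_def)
  then have "densely_defined quotient"
    unfolding densely_defined_def using hermitian_injective_range_dense[OF B inj] by simp
  ultimately show ?thesis using adjoint_quotient by (simp add: self_adjoint_def)
qed

lemma nonneg_quotient: "nonneg_op quotient"
  unfolding nonneg_op_def
proof (clarify)
  fix f h assume fh: "(f, h) \<in> quotient"
  have "cinner h f = cinner f h" using self_adjoint_symmetric[OF self_adjoint_quotient fh fh] .
  then have "Im (cinner h f) = 0" by (subst (asm) cinner_commute[of f]) (simp add: complex_eq_iff)
  moreover have "0 \<le> Re (cinner h f)"
    using fh nonneg by (auto simp: quotient_def comm hermitianD[OF B])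
  ultimately show "cinner h f \<in> \<real>\<^sub>\<ge>\<^sub>0" by (simp add: complex_nonneg_Reals_iff)
qed

lemma quotient_square:
  "quotient O quotient =
     range (\<lambda>u. (blinfun_apply B (blinfun_apply B u), blinfun_apply A (blinfun_apply A u)))"
proof (intro equalityI subsetI)
  fix p assume "p \<in> quotient O quotient"
  then obtain f x h where p: "p = (f, h)" and 1: "(f, x) \<in> quotient" and 2: "(x, h) \<in> quotient"
    by blast
  \<comment> \<open>\<open>(f, h) = (B\<^sup>2 u, A\<^sup>2 u)\<close> forces \<open>u = f + h\<close>\<close>
  let ?u = "f + h"
  have eq: "blinfun_apply B (blinfun_apply B h) = blinfun_apply A (blinfun_apply A f)"
    using 1 2 comm[of x] by (simp add: quotient_iff)
  have "blinfun_apply B (blinfun_apply B ?u) = f"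
    using sum_squares[of f] by (simp add: blinfun.add_right eq add.commute)
  moreover have "blinfun_apply A (blinfun_apply A ?u) = h"
    using sum_squares[of h] by (simp add: blinfun.add_right add.commute flip: eq)
  ultimately have "p = (blinfun_apply B (blinfun_apply B ?u), blinfun_apply A (blinfun_apply A ?u))"
    by (simp only: p)
  then show "p \<in> range (\<lambda>u. (blinfun_apply B (blinfun_apply B u),
      blinfun_apply A (blinfun_apply A u)))" by (rule range_eqI)
next
  fix p assume "p \<in> range (\<lambda>u. (blinfun_apply B (blinfun_apply B u),
      blinfun_apply A (blinfun_apply A u)))"
  then obtain u where p: "p = (blinfun_apply B (blinfun_apply B u),
      blinfun_apply A (blinfun_apply A u))" by blast
  show "p \<in> quotient O quotient"
    unfolding p using quotientI[of "blinfun_apply B u"] quotientI[of "blinfun_apply A u"]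
    by (auto simp: comm)
qed

end

text \<open>
  The operator \<open>K = S R\<close> is everywhere defined and bounded for every non-negative self-adjoint root \<open>S\<close>
  of \<open>T = R\<^sup>-\<^sup>1 - 1\<close>. Its properties follow by splitting a vector as \<open>x = R x + S (S R x)\<close>. The last
  clause says that \<open>R S \<subseteq> S R\<close>, from which commutation with \<open>R\<close> and the value of \<open>K\<^sup>2\<close>
  are read off.
\<close>

lemma root_times_resolvent:
  assumes sa: "self_adjoint S" and nn: "nonneg_op S"
    and sq: "S O S = range (\<lambda>u. (blinfun_apply R u, u - blinfun_apply R u))"
    and bnd: "norm R \<le> 1"
  obtains K where "hermitian K"
    "\<And>x. (blinfun_apply R x, blinfun_apply K x) \<in> S"
    "\<And>x. (blinfun_apply K x, x - blinfun_apply R x) \<in> S"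
    "\<And>x. 0 \<le> Re (cinner (blinfun_apply K x) (x::'a::complex_hilbert))"
    "\<And>z s. (z, s) \<in> S \<Longrightarrow> blinfun_apply R s = blinfun_apply K z"
proof -
  have "(blinfun_apply R x, x - blinfun_apply R x) \<in> S O S" for x
    unfolding sq by (rule rangeI)
  then have "\<exists>w. (blinfun_apply R x, w) \<in> S \<and> (w, x - blinfun_apply R x) \<in> S" for x
    by blast
  then obtain k where k1: "\<And>x. (blinfun_apply R x, k x) \<in> S"
    and k2: "\<And>x. (k x, x - blinfun_apply R x) \<in> S" by metis
  have split: "cinner u x = cinner u (blinfun_apply R x) + cinner u (x - blinfun_apply R x)"
    "cinner x u = cinner (blinfun_apply R x) u + cinner (x - blinfun_apply R x) u" for u x
    by (simp_all add: cinner_diff_left cinner_diff_right)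
  have sym: "cinner (k x) y = cinner x (k y)" for x y
    unfolding split(1)[of "k x" y] split(2)[of x "k y"]
    using self_adjoint_symmetric[OF sa k1[of x] k1[of y]]
      self_adjoint_symmetric[OF sa k2[of x] k2[of y]] by simp
  have "(norm (k x))\<^sup>2 \<le> (norm x)\<^sup>2" for x
  proof -
    have "cinner (k x) (k x) = cinner (blinfun_apply R x) (x - blinfun_apply R x)"
      by (rule self_adjoint_symmetric[OF sa k1 k2])
    then have "(norm (k x))\<^sup>2 = Re (cinner (blinfun_apply R x) x) - (norm (blinfun_apply R x))\<^sup>2"
      by (metis Re_cinner_self cinner_diff_right minus_complex.sel(1))
    also have "\<dots> \<le> norm (blinfun_apply R x) * norm x"
      using Re_cinner_le[of "blinfun_apply R x" x] zero_le_power2[of "norm (blinfun_apply R x)"]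
      by linarith
    also have "norm (blinfun_apply R x) \<le> 1 * norm x"
      using norm_blinfun[of R x] mult_right_mono[OF bnd norm_ge_zero[of x]] by linarith
    then have "norm (blinfun_apply R x) * norm x \<le> (norm x)\<^sup>2"
      unfolding power2_eq_square by (intro mult_right_mono) simp_all
    finally show ?thesis .
  qed
  then have bndk: "norm (k x) \<le> norm x" for x by (rule power2_le_imp_le) simp
  obtain K where K: "hermitian K" "blinfun_apply K = k" "norm K \<le> 1"
    using hermitian_blinfunI[OF sym bndk] by blast
  have nnk: "0 \<le> Re (cinner (k x) x)" for x
    unfolding split(1)[of "k x" x]
    using Re_nonneg_op[OF nn k1[of x]] Re_nonneg_op[OF nn k2[of x]]
    by (simp add: Re_cinner_commute[of "k x" "x - blinfun_apply R x"])
  have "blinfun_apply R s = k z" if zs: "(z, s) \<in> S" for z s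
  proof -
    have lin: "linear_operator S" using sa by (simp add: self_adjoint_def)
    \<comment> \<open>as \<open>S\<close> is linear, \<open>S (S (k z)) = S (z - R z) = s - k z\<close>, so \<open>k z\<close> solves \<open>y + T y = s\<close>\<close>
    have "(z - blinfun_apply R z, s - k z) \<in> S"
      using lin zs k1 by (rule linear_operator_diff)
    with k2[of z] have "(k z, s - k z) \<in> S O S" by blast
    then obtain u where u: "k z = blinfun_apply R u" "s - k z = u - blinfun_apply R u"
      unfolding sq by blast
    then have "s = u" by simp
    with u(1) show ?thesis by simp
  qed
  then show ?thesis using that[of K] K k1 k2 nnk by simp
qed

text \<open>
  The hypotheses on \<open>R\<close> say that \<open>T\<close> is a non-negative self-adjoint operator with \<open>R = (1 + T)\<^sup>-\<^sup>1\<close>.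
  Existence is the operator \<open>A B\<^sup>-\<^sup>1\<close> for the roots \<open>B\<close> of \<open>R\<close> and \<open>A\<close> of \<open>1 - R\<close>. For uniqueness,
  \<open>S R = A B\<close> forces \<open>S\<close> into the graph of \<open>A B\<^sup>-\<^sup>1\<close>, and self-adjoint operators cannot be properly
  included in each other.
\<close>

theorem positive_sqrt_ex1:
  fixes R :: "'a::complex_hilbert \<Rightarrow>\<^sub>L 'a"
  assumes R: "hermitian R" "norm R \<le> 1" "norm (id_blinfun - R) \<le> 1"
    and inj: "\<And>x. blinfun_apply R x = 0 \<Longrightarrow> x = 0"
    and T: "T = range (\<lambda>u. (blinfun_apply R u, u - blinfun_apply R u))"
  shows "\<exists>!S. self_adjoint S \<and> nonneg_op S \<and> S O S = T"
proof -
  obtain B where B: "hermitian B" "norm (id_blinfun - B) \<le> 1" "B o\<^sub>L B = R"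
    and Bcomm: "\<And>Z. Z o\<^sub>L R = R o\<^sub>L Z \<Longrightarrow> Z o\<^sub>L B = B o\<^sub>L Z"
    using bounded_sqrt[OF R(1,3)] by blast
  have R': "hermitian (id_blinfun - R)" "norm (id_blinfun - (id_blinfun - R)) \<le> 1"
    using R by (simp_all add: hermitian_diff hermitian_id)
  obtain A where A: "hermitian A" "norm (id_blinfun - A) \<le> 1"
    "A o\<^sub>L A = id_blinfun - R"
    and Acomm: "\<And>Z. Z o\<^sub>L (id_blinfun - R) = (id_blinfun - R) o\<^sub>L Z \<Longrightarrow> Z o\<^sub>L A = A o\<^sub>L Z"
    using bounded_sqrt[OF R'] by blast
  \<comment> \<open>a root of \<open>B\<close> commuting with \<open>A\<close> shows \<open>A B = Q A Q \<ge> 0\<close>\<close>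
  obtain Q where Q: "hermitian Q" "norm (id_blinfun - Q) \<le> 1" "Q o\<^sub>L Q = B"
    and Qcomm: "\<And>Z. Z o\<^sub>L B = B o\<^sub>L Z \<Longrightarrow> Z o\<^sub>L Q = Q o\<^sub>L Z"
    using bounded_sqrt[OF B(1,2)] by blast
  have BR: "B o\<^sub>L R = R o\<^sub>L B" unfolding B(3)[symmetric] by (rule blinfun_eqI) simp
  have BA: "B o\<^sub>L A = A o\<^sub>L B" by (rule Acomm[OF commutes_id_minus[OF BR]])
  have AQ: "A o\<^sub>L Q = Q o\<^sub>L A" by (rule Qcomm) (simp add: BA)
  have B2: "blinfun_apply B (blinfun_apply B x) = blinfun_apply R x" for x
    using arg_cong[OF B(3), of "\<lambda>X. blinfun_apply X x"] by simp
  have A2: "blinfun_apply A (blinfun_apply A x) = x - blinfun_apply R x" for x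
    using arg_cong[OF A(3), of "\<lambda>X. blinfun_apply X x"] by (simp add: blinfun.diff_left)
  have Q2: "blinfun_apply Q (blinfun_apply Q x) = blinfun_apply B x" for x
    using arg_cong[OF Q(3), of "\<lambda>X. blinfun_apply X x"] by simp
  have ABx: "blinfun_apply A (blinfun_apply B x) = blinfun_apply B (blinfun_apply A x)" for x
    using arg_cong[OF BA, of "\<lambda>X. blinfun_apply X x"] by simp
  have AQx: "blinfun_apply A (blinfun_apply Q x) = blinfun_apply Q (blinfun_apply A x)" for x
    using arg_cong[OF AQ, of "\<lambda>X. blinfun_apply X x"] by simp
  interpret cosine_sine_pair A B
  proof
    show "blinfun_apply A (blinfun_apply A x) + blinfun_apply B (blinfun_apply B x) = x" for x
      by (simp add: A2 B2)
    show "x = 0" if "blinfun_apply B x = 0" for x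
      by (rule inj) (simp add: that flip: B2)
    show "0 \<le> Re (cinner (blinfun_apply A (blinfun_apply B x)) x)" for x
    proof -
      have "cinner (blinfun_apply A (blinfun_apply B x)) x
          = cinner (blinfun_apply A (blinfun_apply Q x)) (blinfun_apply Q x)"
        unfolding Q2[symmetric] AQx by (simp only: hermitianD[OF Q(1)])
      then show ?thesis using nonneg_if_norm_id_minus[OF A(2), of "blinfun_apply Q x"] by simp
    qed
  qed (rule A(1) B(1) ABx)+
  have sqT: "quotient O quotient = T"
    unfolding quotient_square T by (simp add: A2 B2)
  show ?thesis
  proof (rule ex1I[of _ quotient])
    show "self_adjoint quotient \<and> nonneg_op quotient \<and> quotient O quotient = T"
      by (simp add: self_adjoint_quotient nonneg_quotient sqT)
  next
    fix S assume S: "self_adjoint S \<and> nonneg_op S \<and> S O S = T"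
    then have sa: "self_adjoint S" and nn: "nonneg_op S"
      and sq: "S O S = range (\<lambda>u. (blinfun_apply R u, u - blinfun_apply R u))"
      by (auto simp: T)
    obtain K where K: "hermitian K"
      and K1: "\<And>x. (blinfun_apply R x, blinfun_apply K x) \<in> S"
      and K2: "\<And>x. (blinfun_apply K x, x - blinfun_apply R x) \<in> S"
      and Knn: "\<And>x. 0 \<le> Re (cinner (blinfun_apply K x) x)"
      and RK: "\<And>z s. (z, s) \<in> S \<Longrightarrow> blinfun_apply R s = blinfun_apply K z"
      using root_times_resolvent[OF sa nn sq R(2)] by blast
    have KR: "K o\<^sub>L R = R o\<^sub>L K" by (rule blinfun_eqI) (simp add: RK[OF K1])
    have KB: "K o\<^sub>L B = B o\<^sub>L K" by (rule Bcomm[OF KR])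
    have KA: "K o\<^sub>L A = A o\<^sub>L K" by (rule Acomm[OF commutes_id_minus[OF KR]])
    have KBx: "blinfun_apply K (blinfun_apply B x) = blinfun_apply B (blinfun_apply K x)" for x
      using arg_cong[OF KB, of "\<lambda>X. blinfun_apply X x"] by simp
    have KAx: "blinfun_apply K (blinfun_apply A x) = blinfun_apply A (blinfun_apply K x)" for x
      using arg_cong[OF KA, of "\<lambda>X. blinfun_apply X x"] by simp
    have "K = A o\<^sub>L B"
    proof (rule hermitian_nonneg_sqrt_unique[OF K _ Knn])
      show "hermitian (A o\<^sub>L B)" by (rule hermitian_compose[OF A(1) B(1)]) (simp add: BA)
      show "0 \<le> Re (cinner (blinfun_apply (A o\<^sub>L B) x) x)" for x using nonneg by simp
      show "blinfun_apply K (blinfun_apply (A o\<^sub>L B) x) = blinfun_apply (A o\<^sub>L B) (blinfun_apply K x)"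
        for x by (simp add: KAx KBx)
      have "blinfun_apply K (blinfun_apply K x) = blinfun_apply R x - blinfun_apply R (blinfun_apply R x)"
        for x by (simp only: RK[OF K2, symmetric] blinfun.diff_right)
      moreover have "blinfun_apply A (blinfun_apply B (blinfun_apply A (blinfun_apply B x)))
          = blinfun_apply R x - blinfun_apply R (blinfun_apply R x)" for x
        by (simp only: ABx[of "blinfun_apply B x", symmetric] A2 B2)
      ultimately show "blinfun_apply K (blinfun_apply K x)
          = blinfun_apply (A o\<^sub>L B) (blinfun_apply (A o\<^sub>L B) x)" for x
        by simp
    qed
    then have K_eq: "blinfun_apply K x = blinfun_apply B (blinfun_apply A x)" for x
      by (simp add: ABx)
    have "S \<subseteq> quotient"
    proof (rule subrelI)
      fix f k assume fk: "(f, k) \<in> S"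
      have "blinfun_apply B (blinfun_apply B k) = blinfun_apply B (blinfun_apply A f)"
        using RK[OF fk] by (simp add: B2 K_eq)
      then have "blinfun_apply B (blinfun_apply A f - blinfun_apply B k) = 0"
        by (simp add: blinfun.diff_right)
      then have "blinfun_apply A f - blinfun_apply B k = 0" by (rule local.inj)
      then show "(f, k) \<in> quotient" by (simp add: quotient_iff)
    qed
    then show "S = quotient" by (rule self_adjoint_eqI[OF sa self_adjoint_quotient])
  qed
qed

section \<open>Orthonormal bases\<close>

lemma orthonormal_projection_norm:
  fixes e :: "nat \<Rightarrow> 'a::complex_inner"
  assumes on: "\<And>n m. cinner (e n) (e m) = (if n = m then 1 else 0)"
  shows "(norm (f - (\<Sum>n<N. cinner f (e n) *\<^sub>C e n)))\<^sup>2
    = (norm f)\<^sup>2 - (\<Sum>n<N. (cmod (cinner f (e n)))\<^sup>2)"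
proof (induction N)
  case (Suc N)
  let ?s = "\<Sum>n<N. cinner f (e n) *\<^sub>C e n"
  have "cinner ?s (e N) = 0"
  proof -
    have "cinner (\<Sum>n<M. cinner f (e n) *\<^sub>C e n) (e N) = 0" if "M \<le> N" for M
      using that by (induction M) (simp_all add: cinner_add_left cinner_scaleC_left on)
    then show ?thesis by simp
  qed
  then have "cinner (f - ?s) (cinner f (e N) *\<^sub>C e N) = cnj (cinner f (e N)) * cinner f (e N)"
    by (simp add: cinner_scaleC_right cinner_diff_left)
  also have "\<dots> = of_real ((cmod (cinner f (e N)))\<^sup>2)"
    by (simp only: complex_norm_square mult.commute)
  finally have "Re (cinner (f - ?s) (cinner f (e N) *\<^sub>C e N)) = (cmod (cinner f (e N)))\<^sup>2"
    by (simp only: Re_complex_of_real)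
  moreover have "norm (e N) = 1"
    using on[of N N] Re_cinner_self[of "e N"] power2_eq_iff_nonneg[of "norm (e N)" 1] by simp
  ultimately have "(norm ((f - ?s) - cinner f (e N) *\<^sub>C e N))\<^sup>2
      = (norm (f - ?s))\<^sup>2 - (cmod (cinner f (e N)))\<^sup>2"
    by (simp only: norm_diff_sq[of "f - ?s"]) (simp add: norm_scaleC)
  with Suc show ?case by (simp add: algebra_simps)
qed simp

text \<open>
  Parseval's identity says that the remainder of the expansion tends to \<open>0\<close>. The remainder operators
  are contractions by Bessel's inequality, so convergence on a dense set spreads to the whole space.
\<close>

lemma orthonormal_basisI:
  fixes e :: "nat \<Rightarrow> 'a::complex_inner"
  assumes on: "\<And>n m. cinner (e n) (e m) = (if n = m then 1 else 0)"
    and dense: "closure U = UNIV"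
    and parseval: "\<And>u. u \<in> U \<Longrightarrow> (\<lambda>n. (cmod (cinner u (e n)))\<^sup>2) sums (norm u)\<^sup>2"
  shows "orthonormal_basis e"
proof -
  define r where "r f N = f - (\<Sum>n<N. cinner f (e n) *\<^sub>C e n)" for f N
  have r_norm: "(norm (r f N))\<^sup>2 = (norm f)\<^sup>2 - (\<Sum>n<N. (cmod (cinner f (e n)))\<^sup>2)" for f N
    unfolding r_def by (rule orthonormal_projection_norm[OF on])
  have r_le: "norm (r f N) \<le> norm f" for f N
    by (rule power2_le_imp_le) (simp_all add: r_norm sum_nonneg)
  have r_diff: "r (f - u) N = r f N - r u N" for f u N
  proof -
    have "cinner (f - u) (e n) *\<^sub>C e n = cinner f (e n) *\<^sub>C e n - cinner u (e n) *\<^sub>C e n" for n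
      using scaleC_add_left[of "cinner (f - u) (e n)" "cinner u (e n)" "e n"]
      by (simp add: cinner_diff_left)
    then show ?thesis by (simp add: r_def sum_subtractf)
  qed
  have "(\<lambda>N. r f N) \<longlonglongrightarrow> 0" for f
  proof (rule LIMSEQ_I)
    fix \<epsilon> :: real assume \<epsilon>: "\<epsilon> > 0"
    have "f \<in> closure U" using dense by simp
    then obtain u where u: "u \<in> U" "dist u f < \<epsilon> / 2"
      using \<epsilon> closure_approachable[of f U] half_gt_zero by blast
    have "(\<lambda>N. (norm u)\<^sup>2 - (\<Sum>n<N. (cmod (cinner u (e n)))\<^sup>2)) \<longlonglongrightarrow> (norm u)\<^sup>2 - (norm u)\<^sup>2"
      using parseval[OF u(1)] unfolding sums_def by (intro tendsto_intros)
    then have "(\<lambda>N. (norm (r u N))\<^sup>2) \<longlonglongrightarrow> 0" by (simp add: r_norm)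
    then have "(\<lambda>N. sqrt ((norm (r u N))\<^sup>2)) \<longlonglongrightarrow> sqrt 0" by (rule tendsto_real_sqrt)
    then have "(\<lambda>N. norm (r u N)) \<longlonglongrightarrow> 0" by simp
    then have "eventually (\<lambda>N. norm (r u N) < \<epsilon> / 2) sequentially"
      by (rule order_tendstoD(2)) (use \<epsilon> in simp)
    then obtain M where M: "\<And>N. N \<ge> M \<Longrightarrow> norm (r u N) < \<epsilon> / 2"
      by (auto simp: eventually_sequentially)
    have "norm (r f N - 0) < \<epsilon>" if "N \<ge> M" for N
    proof -
      have "norm (r f N) \<le> norm (r (f - u) N) + norm (r u N)"
        unfolding r_diff using norm_triangle_ineq[of "r f N - r u N" "r u N"] by simp
      also have "\<dots> < \<epsilon> / 2 + \<epsilon> / 2"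
        using r_le[of "f - u" N] u(2) M[OF that] by (simp add: dist_norm norm_minus_commute)
      finally show ?thesis by simp
    qed
    then show "\<exists>M. \<forall>N\<ge>M. norm (r f N - 0) < \<epsilon>" by blast
  qed
  then have "(\<lambda>N. f - r f N) \<longlonglongrightarrow> f - 0" for f by (intro tendsto_intros)
  then have "(\<lambda>n. cinner f (e n) *\<^sub>C e n) sums f" for f by (simp add: sums_def r_def)
  then show ?thesis unfolding orthonormal_basis_def using on by blast
qed

section \<open>The frame form\<close>

lemma summable_frame_form:
  assumes f: "f \<in> Domain (analysis_op \<phi>)" and g: "g \<in> Domain (analysis_op \<phi>)"
  shows "summable (\<lambda>n. cinner f (\<phi> n) * cinner (\<phi> n) g)"
proof (rule summable_comparison_test)
  show "summable (\<lambda>n. (cmod (cinner f (\<phi> n)))\<^sup>2 + (cmod (cinner g (\<phi> n)))\<^sup>2)"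
    using f g by (intro summable_add) (auto simp: analysis_op_def)
  have "norm (cinner f (\<phi> n) * cinner (\<phi> n) g)
      \<le> (cmod (cinner f (\<phi> n)))\<^sup>2 + (cmod (cinner g (\<phi> n)))\<^sup>2" for n
  proof -
    have eq: "cmod (cinner (\<phi> n) g) = cmod (cinner g (\<phi> n))" by (subst cinner_commute) simp
    show ?thesis
      using sum_squares_bound[of "cmod (cinner f (\<phi> n))" "cmod (cinner g (\<phi> n))"]
        zero_le_power2[of "cmod (cinner f (\<phi> n))"] zero_le_power2[of "cmod (cinner g (\<phi> n))"]
      unfolding norm_mult eq by linarith
  qed
  then show "\<exists>N. \<forall>n\<ge>N. norm (cinner f (\<phi> n) * cinner (\<phi> n) g)
      \<le> (cmod (cinner f (\<phi> n)))\<^sup>2 + (cmod (cinner g (\<phi> n)))\<^sup>2" by blast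
qed

lemma Domain_analysis_op_iff:
  "f \<in> Domain (analysis_op \<phi>) \<longleftrightarrow> summable (\<lambda>n. (cmod (cinner f (\<phi> n)))\<^sup>2)"
  by (auto simp: analysis_op_def)

lemma frame_form_self_sums:
  assumes "f \<in> Domain (analysis_op \<phi>)"
  shows "(\<lambda>n. (cmod (cinner f (\<phi> n)))\<^sup>2) sums Re (frame_form \<phi> f f)"
proof -
  have "cinner f (\<phi> n) * cinner (\<phi> n) f = of_real ((cmod (cinner f (\<phi> n)))\<^sup>2)" for n
    unfolding complex_norm_square by (subst (2) cinner_commute) simp
  then have "Re (cinner f (\<phi> n) * cinner (\<phi> n) f) = (cmod (cinner f (\<phi> n)))\<^sup>2" for n
    by simp
  then show ?thesis
    using sums_Re[OF summable_sums[OF summable_frame_form[OF assms assms]]]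
    unfolding frame_form_def by simp
qed

lemma complex_subspace_analysis_domain: "complex_subspace (Domain (analysis_op \<phi>))"
  unfolding complex_subspace_def
proof (intro conjI ballI allI)
  show "0 \<in> Domain (analysis_op \<phi>)" by (simp add: Domain_analysis_op_iff)
next
  fix f g assume fg: "f \<in> Domain (analysis_op \<phi>)" "g \<in> Domain (analysis_op \<phi>)"
  have "(cmod (a + b))\<^sup>2 \<le> 2 * (cmod a)\<^sup>2 + 2 * (cmod b)\<^sup>2" for a b
  proof -
    have "(cmod (a + b))\<^sup>2 \<le> (cmod a + cmod b)\<^sup>2"
      by (intro power_mono norm_triangle_ineq norm_ge_zero)
    then show ?thesis using sum_squares_bound[of "cmod a" "cmod b"] by (simp add: power2_sum)
  qed
  then have le: "norm ((cmod (cinner (f + g) (\<phi> n)))\<^sup>2)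
      \<le> 2 * (cmod (cinner f (\<phi> n)))\<^sup>2 + 2 * (cmod (cinner g (\<phi> n)))\<^sup>2" for n
    by (simp add: cinner_add_left)
  have "summable (\<lambda>n. 2 * (cmod (cinner f (\<phi> n)))\<^sup>2 + 2 * (cmod (cinner g (\<phi> n)))\<^sup>2)"
    using fg by (intro summable_add summable_mult) (auto simp: Domain_analysis_op_iff)
  then show "f + g \<in> Domain (analysis_op \<phi>)"
    unfolding Domain_analysis_op_iff by (rule summable_comparison_test'[where N = 0]) (rule le)
next
  fix c f assume "f \<in> Domain (analysis_op \<phi>)"
  then show "c *\<^sub>C f \<in> Domain (analysis_op \<phi>)"
    by (simp add: Domain_analysis_op_iff cinner_scaleC_left norm_mult power_mult_distrib summable_mult)
qed

text \<open>
  Closedness is Fatou's lemma for series: each partial sum of the squared coefficients is continuous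
  in \<open>f\<close>, so it inherits the bound from the approximating vectors.
\<close>

lemma closed_form_frame:
  "closed_form (Domain (analysis_op \<phi>)) (frame_form (\<phi> :: nat \<Rightarrow> 'a::complex_hilbert))"
proof
  let ?D = "Domain (analysis_op \<phi>)"
  show "complex_subspace ?D" by (rule complex_subspace_analysis_domain)
  show "frame_form \<phi> (f + g) h = frame_form \<phi> f h + frame_form \<phi> g h"
    if "f \<in> ?D" "g \<in> ?D" "h \<in> ?D" for f g h
    unfolding frame_form_def using that
    by (subst suminf_add) (auto intro: summable_frame_form simp: cinner_add_left distrib_right)
  show "frame_form \<phi> (c *\<^sub>C f) g = c * frame_form \<phi> f g" if "f \<in> ?D" "g \<in> ?D" for f g c
    unfolding frame_form_def using that
    by (subst suminf_mult[symmetric]) (auto intro: summable_frame_form simp: cinner_scaleC_left mult.assoc)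
  show "frame_form \<phi> f g = cnj (frame_form \<phi> g f)" if "f \<in> ?D" "g \<in> ?D" for f g
  proof -
    have "(\<lambda>n. cnj (cinner g (\<phi> n) * cinner (\<phi> n) f)) sums cnj (frame_form \<phi> g f)"
      unfolding frame_form_def sums_cnj by (rule summable_sums[OF summable_frame_form[OF that(2,1)]])
    moreover have "cnj (cinner g (\<phi> n) * cinner (\<phi> n) f) = cinner f (\<phi> n) * cinner (\<phi> n) g" for n
      by (simp flip: cinner_commute)
    ultimately show ?thesis unfolding frame_form_def by (simp add: sums_iff)
  qed
  show "0 \<le> Re (frame_form \<phi> f f)" if "f \<in> ?D" for f
    by (rule sums_le[OF _ sums_zero frame_form_self_sums[OF that]]) simp
  show "f \<in> ?D \<and> Re (frame_form \<phi> f f) \<le> b"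
    if X: "\<And>n. X n \<in> ?D" "X \<longlonglongrightarrow> f" "\<And>n. Re (frame_form \<phi> (X n) (X n)) \<le> b" for X f b
  proof -
    have partial: "(\<Sum>n<N. (cmod (cinner f (\<phi> n)))\<^sup>2) \<le> b" for N
    proof (rule tendsto_upperbound)
      show "(\<lambda>k. \<Sum>n<N. (cmod (cinner (X k) (\<phi> n)))\<^sup>2) \<longlonglongrightarrow> (\<Sum>n<N. (cmod (cinner f (\<phi> n)))\<^sup>2)"
        by (intro tendsto_intros tendsto_cinner X(2))
      have "(\<Sum>n<N. (cmod (cinner (X k) (\<phi> n)))\<^sup>2) \<le> b" for k
        using sum_le_suminf[OF sums_summable[OF frame_form_self_sums[OF X(1)[of k]]], of "{..<N}"]
          sums_unique[OF frame_form_self_sums[OF X(1)[of k]]] X(3)[of k] by simp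
      then show "eventually (\<lambda>k. (\<Sum>n<N. (cmod (cinner (X k) (\<phi> n)))\<^sup>2) \<le> b) sequentially" by simp
    qed simp
    have f: "f \<in> ?D"
      unfolding Domain_analysis_op_iff
      by (rule summableI_nonneg_bounded[of _ b]) (simp_all add: partial)
    have "Re (frame_form \<phi> f f) \<le> b"
      using suminf_le_const[OF sums_summable[OF frame_form_self_sums[OF f]] partial]
        sums_unique[OF frame_form_self_sums[OF f]] by simp
    with f show ?thesis by blast
  qed
qed

section \<open>The orthonormal basis\<close>

text \<open>
  The hypothesis \<open>onto\<close> says that \<open>1 + S\<^sup>2\<close> is onto. Then \<open>K = S (1 + S\<^sup>2)\<^sup>-\<^sup>1\<close> is hermitian with range in
  the given set. A vector \<open>v\<close> orthogonal to that set satisfies \<open>\<langle>K v|x\<rangle> = \<langle>v|K x\<rangle> = 0\<close> for all \<open>x\<close>,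
  and \<open>K\<close> is injective because \<open>S\<close> is.
\<close>

lemma dense_Domain_Int_Range:
  fixes S :: "('a::complex_hilbert \<times> 'a) set"
  assumes sa: "self_adjoint S" and ker: "\<And>f. (f, 0) \<in> S \<Longrightarrow> f = 0"
    and onto: "\<And>x. \<exists>y w. (y, w) \<in> S \<and> (w, x - y) \<in> S"
  shows "closure (Domain S \<inter> Range S) = UNIV"
proof (rule dense_if_orthogonal_trivial)
  have lin: "linear_operator S" using sa by (simp add: self_adjoint_def)
  then show "complex_subspace (Domain S \<inter> Range S)"
    unfolding complex_subspace_def linear_operator_def by fast
  fix v assume v: "\<And>g. g \<in> Domain S \<inter> Range S \<Longrightarrow> cinner v g = 0"
  obtain y w where yw: "(y, w) \<in> S" "(w, v - y) \<in> S" using onto by blast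
  have "cinner w x = 0" for x
  proof -
    obtain y' w' where yw': "(y', w') \<in> S" "(w', x - y') \<in> S" using onto by blast
    have "cinner w y' = cinner y w'" "cinner (v - y) w' = cinner w (x - y')"
      by (rule self_adjoint_symmetric[OF sa yw(1) yw'(1)],
          rule self_adjoint_symmetric[OF sa yw(2) yw'(2)])
    then have "cinner w x = cinner v w'" by (simp add: cinner_diff_left cinner_diff_right)
    also have "\<dots> = 0" using v yw' by blast
    finally show ?thesis .
  qed
  then have w: "w = 0" by (simp flip: cinner_eq_zero_iff)
  have "(0, 0) \<in> S" "single_valued S" using lin by (simp_all add: linear_operator_def)
  then have "v - y = 0" using yw(2) w by (auto dest: single_valuedD)
  moreover have "y = 0" using ker yw(1) w by simp
  ultimately show "v = 0" by simp
qed

theorem corollary6p3: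
  fixes \<phi> \<psi> :: "nat \<Rightarrow> 'a::complex_hilbert"
  assumes "separable_space (euclidean :: 'a topology)"
    and "biorthogonal \<phi> \<psi>"
    and "total_seq \<phi>"
    and "total_seq \<psi>"
  shows "densely_defined (analysis_op \<phi>) \<and>
    (\<forall>n. \<phi> n \<in> Range (gen_frame_op \<phi>)) \<and>
    Range (gen_frame_op \<phi>) \<subseteq> Range (sqrt_op (gen_frame_op \<phi>)) \<and>
    orthonormal_basis (\<lambda>n. op_app ((sqrt_op (gen_frame_op \<phi>))\<inverse>) (\<phi> n))"
proof -
  let ?D = "Domain (analysis_op \<phi>)" and ?T = "gen_frame_op \<phi>"
  define S where "S = sqrt_op ?T"
  interpret closed_form ?D "frame_form \<phi>" by (rule closed_form_frame)
  have bi: "cinner (\<psi> n) (\<phi> m) = (if n = m then 1 else 0)" for n m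
    using assms(2) by (simp add: biorthogonal_def)
  have \<psi>D: "\<psi> n \<in> ?D" for n
  proof -
    have "(\<lambda>m. (cmod (cinner (\<psi> n) (\<phi> m)))\<^sup>2) = (\<lambda>m. if m = n then 1 else 0)"
      by (auto simp: bi)
    then show ?thesis unfolding Domain_analysis_op_iff by simp
  qed
  have orth: "u = 0" if "\<And>g. g \<in> ?D \<Longrightarrow> cinner u g = 0" for u
    using assms(4) that \<psi>D unfolding total_seq_def by blast
  have dense: "closure ?D = UNIV" by (rule dense_if_orthogonal_trivial[OF subspace orth])
  obtain R where R: "hermitian R" "norm R \<le> 1" "norm (id_blinfun - R) \<le> 1"
    and RD: "\<And>h. blinfun_apply R h \<in> ?D"
    and Req: "\<And>h g. g \<in> ?D \<Longrightarrow>
      cinner (blinfun_apply R h) g + frame_form \<phi> (blinfun_apply R h) g = cinner h g"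
    using resolvent by blast
  have T: "?T = range (\<lambda>u. (blinfun_apply R u, u - blinfun_apply R u))"
    unfolding gen_frame_op_def by (rule form_operator_eq_range[OF RD Req])
  have injR: "x = 0" if "blinfun_apply R x = 0" for x
  proof (rule orth)
    fix g assume g: "g \<in> ?D"
    have "frame_form \<phi> 0 g = 0" by (simp add: frame_form_def)
    then show "cinner x g = 0" using Req[OF g, of x] that by simp
  qed
  have "self_adjoint S \<and> nonneg_op S \<and> S O S = ?T"
    unfolding S_def sqrt_op_def by (rule theI'[OF positive_sqrt_ex1[OF R injR T]])
  then have sa: "self_adjoint S" and sq: "S O S = ?T" by auto
  have lin: "linear_operator S" using sa by (simp add: self_adjoint_def)
  have TD: "f \<in> ?D" "\<And>g. g \<in> ?D \<Longrightarrow> frame_form \<phi> f g = cinner h g" if "(f, h) \<in> ?T" for f h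
    using that unfolding gen_frame_op_def form_operator_def by auto
  \<comment> \<open>\<open>S f = 0\<close> implies \<open>T f = 0\<close>, hence \<open>\<Sum>|\<langle>f|\<phi>\<^sub>n\<rangle>|\<^sup>2 = \<Omega> f f = 0\<close>\<close>
  have ker: "f = 0" if f: "(f, 0) \<in> S" for f
  proof -
    have "(0, 0) \<in> S" using lin by (simp add: linear_operator_def)
    with f have f0: "(f, 0) \<in> ?T" using sq by blast
    have "(\<lambda>n. (cmod (cinner f (\<phi> n)))\<^sup>2) sums 0"
      using frame_form_self_sums[OF TD(1)[OF f0]] TD(2)[OF f0 TD(1)[OF f0]] by simp
    then have "cinner f (\<phi> n) = 0" for n
      using suminf_eq_zero_iff[of "\<lambda>n. (cmod (cinner f (\<phi> n)))\<^sup>2"] by (auto simp: sums_iff)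
    then show ?thesis using assms(3) unfolding total_seq_def by blast
  qed
  have T\<psi>: "(\<psi> n, \<phi> n) \<in> ?T" for n
  proof -
    have "frame_form \<phi> (\<psi> n) g = cinner (\<phi> n) g" for g
    proof -
      have "(\<lambda>m. if m = n then cinner (\<phi> m) g else 0) sums cinner (\<phi> n) g"
        by (rule sums_single)
      moreover have "(\<lambda>m. if m = n then cinner (\<phi> m) g else 0)
          = (\<lambda>m. cinner (\<psi> n) (\<phi> m) * cinner (\<phi> m) g)"
        by (auto simp: bi)
      ultimately show ?thesis unfolding frame_form_def by (simp add: sums_iff)
    qed
    then show ?thesis using \<psi>D by (simp add: gen_frame_op_def form_operator_def)
  qed
  then have "\<exists>e. (\<psi> n, e) \<in> S \<and> (e, \<phi> n) \<in> S" for n using sq by blast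
  then obtain e where e1: "\<And>n. (\<psi> n, e n) \<in> S" and e2: "\<And>n. (e n, \<phi> n) \<in> S" by metis
  have e_eq: "op_app (S\<inverse>) (\<phi> n) = e n" for n
    unfolding op_app_def
  proof (rule the_equality)
    show "(\<phi> n, e n) \<in> S\<inverse>" using e2 by simp
    fix h assume "(\<phi> n, h) \<in> S\<inverse>"
    then have "(h, \<phi> n) \<in> S" by simp
    then have "(h - e n, \<phi> n - \<phi> n) \<in> S" using e2[of n] by (rule linear_operator_diff[OF lin])
    then have "h - e n = 0" unfolding diff_self by (rule ker)
    then show "h = e n" by simp
  qed
  have "orthonormal_basis e"
  proof (rule orthonormal_basisI)
    show "cinner (e n) (e m) = (if n = m then 1 else 0)" for n m
      using self_adjoint_symmetric[OF sa e1[of n] e2[of m]] by (simp add: bi)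
    show "closure (Domain S \<inter> Range S) = UNIV"
    proof (rule dense_Domain_Int_Range[OF sa ker])
      fix x
      have "(blinfun_apply R x, x - blinfun_apply R x) \<in> S O S" unfolding sq T by (rule rangeI)
      then show "\<exists>y w. (y, w) \<in> S \<and> (w, x - y) \<in> S" by blast
    qed
    fix u assume "u \<in> Domain S \<inter> Range S"
    then obtain g h where gu: "(g, u) \<in> S" and uh: "(u, h) \<in> S" by blast
    then have gh: "(g, h) \<in> ?T" using sq by blast
    have "cinner u (e n) = cinner g (\<phi> n)" for n
      by (rule self_adjoint_symmetric[OF sa gu e2])
    moreover have "Re (frame_form \<phi> g g) = (norm u)\<^sup>2"
      using TD(2)[OF gh TD(1)[OF gh]] self_adjoint_symmetric[OF sa uh gu]
      by (simp add: Re_cinner_self)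
    ultimately show "(\<lambda>n. (cmod (cinner u (e n)))\<^sup>2) sums (norm u)\<^sup>2"
      using frame_form_self_sums[OF TD(1)[OF gh]] by simp
  qed
  then have "orthonormal_basis (\<lambda>n. op_app (S\<inverse>) (\<phi> n))" by (simp add: e_eq)
  moreover have "Range ?T \<subseteq> Range S" unfolding sq[symmetric] by blast
  moreover have "\<forall>n. \<phi> n \<in> Range ?T" using T\<psi> by blast
  ultimately show ?thesis using dense by (simp add: S_def densely_defined_def)
qed

end
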